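(* Let $p$ be a prime, let $R$ be a commutative ring of characteristic $p$, and let $r,m$ be positive integers with $r+1<m$. Let $A=T(V_r(R[x_1,\dots,x_m]))$ be the twisted ring of the $r$-th Veronese subring of the polynomial ring $R[x_1,\dots,x_m]$. Let $U=(u_{ij})$ be the $(m-r-1)\times(m-r-1)$ matrix with entries $$u_{ij}=M_{p,m}\bigl(r(p-1)+ip-j\bigr),\qquad 1\le i,j\le m-r-1,$$ and let $m(T)=T^s+a_1T^{s-1}+\cdots+a_s$ be the minimal polynomial of $U$. Then the complexity sequence $\{c_e\}_{e\ge 0}=\{c_e(A)\}_{e\ge 0}$ satisfies the linear recurrence $$c_{e+s}+a_1c_{e+s-1}+\cdots+a_sc_e=0\qquad\text{for all } e\ge 2.$$
   Context: The integers $M_{p,m}(k)$: for $k\in\mathbb{Z}$, $M_{p,m}(k):=\operatorname{rank}_R\bigl(R[x_1,\dots,x_m]/(x_1^p,\dots,x_m^p)\bigr)_k$; equivalently they are the coefficients in $\sum_{k=0}^{m(p-1)}M_{p,m}(k)T^k=(1+T+\cdots+T^{p-1})^m$, with $M_{p,m}(k)=0$ for $k<0$ and for $k>m(p-1)$. The matrix $U$ is thus an integer matrix, and its minimal polynomial is taken as that of a matrix over $\mathbb{Q}$ (equivalently over $\mathbb{C}$). Veronese subring: with $S=R[x_1,\dots,x_m]=\bigoplus_{k\ge 0}S_k$ graded by total degree (elements of $R$ in degree $0$, each $x_i$ in degree $1$), $V_r(S)=\bigoplus_{k\ge 0}S_{rk}$, regarded as an $\mathbb{N}$-graded ring with $k$-th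 graded piece $S_{rk}$. Twisted ring: for an $\mathbb{N}$-graded commutative ring $\mathscr{R}=\bigoplus_{n\ge 0}\mathscr{R}_n$ of characteristic $p>0$, $T(\mathscr{R})=\bigoplus_{e\ge 0}\mathscr{R}_{p^e-1}$ is the $\mathbb{N}$-graded (generally noncommutative) ring with degree $e$ piece $T(\mathscr{R})_e=\mathscr{R}_{p^e-1}$ and multiplication $a* b=ab^{p^e}$ for $a\in T(\mathscr{R})_e$, $b\in T(\mathscr{R})_{e'}$ (the right-hand product being taken in $\mathscr{R}$). Hence here $A_e=S_{r(p^e-1)}$ and $A_0=R$. Complexity sequence: for an $\mathbb{N}$-graded ring $A=\bigoplus_{e\ge 0}A_e$ (not necessarily commutative), set $G_{-1}(A)=A_0$, and for $e\ge 0$ let $G_e(A)$ be the subring of $A$ generated by the elements of degree $\le e$. Let $(G_{e-1}(A))_e$ denote the degree $e$ component of $G_{e-1}(A)$. Then $c_e(A)$ is the (minimal) number of homogeneous generators of $A_e/(G_{e-1}(A))_e$ over $A_0$ (as a left $A_0$-module). *)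

theory Defs
  imports
    "HOL-Library.Poly_Mapping"
    "HOL-Computational_Algebra.Primes"
    "HOL-Computational_Algebra.Polynomial"
    "HOL-Algebra.Generated_Rings"
    "HOL-Algebra.AbelCoset"
    "HOL-Algebra.Module"
    "Jordan_Normal_Form.Matrix"
begin

text \<open>
  An \<open>\<nat>\<close>-graded commutative ring is given internally, by the family of its graded pieces
  \<open>P n\<close> inside an ambient commutative ring type; the ring itself is the direct sum of the pieces.
  A polynomial over \<open>'a\<close> is a finitely supported map from monomials to \<open>'a\<close>, a monomial being a
  finitely supported map from variable indices to exponents.  The family below is
  \<open>R[x\<^sub>1,...,x\<^sub>m]\<close> graded by total degree: only the variables \<open>1,...,m\<close> may occur.
\<close>

definition poly_piece :: "nat \<Rightarrow> nat \<Rightarrow> ((nat \<Rightarrow>\<^sub>0 nat) \<Rightarrow>\<^sub>0 'a::comm_ring_1) set" where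
  "poly_piece m k =
     {f. \<forall>t \<in> Poly_Mapping.keys f.
           Poly_Mapping.keys t \<subseteq> {1..m} \<and> (\<Sum>i=1..m. Poly_Mapping.lookup t i) = k}"

definition veronese :: "nat \<Rightarrow> (nat \<Rightarrow> 'b set) \<Rightarrow> nat \<Rightarrow> 'b set" where
  "veronese r P k = P (r * k)"

text \<open>
  The elements of \<open>T(P) = \<Oplus>\<^sub>e P (p\<^sup>e - 1)\<close> are finitely supported sequences of components.
  The product is the bilinear extension of \<open>a * b = a b\<^bsup>p^e\<^esup>\<close> for \<open>a\<close> of degree \<open>e\<close>.
\<close>

definition twisted_ring :: "nat \<Rightarrow> (nat \<Rightarrow> 'b::comm_ring_1 set) \<Rightarrow> (nat \<Rightarrow> 'b) ring" where
  "twisted_ring p P =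
     \<lparr>carrier = {f. finite {e. f e \<noteq> 0} \<and> (\<forall>e. f e \<in> P (p ^ e - 1))},
      mult = (\<lambda>f g n. \<Sum>e\<le>n. f e * g (n - e) ^ (p ^ e)),
      one = (\<lambda>e. if e = 0 then 1 else 0),
      zero = (\<lambda>e. 0),
      add = (\<lambda>f g e. f e + g e)\<rparr>"

definition twisted_piece :: "nat \<Rightarrow> (nat \<Rightarrow> 'b::comm_ring_1 set) \<Rightarrow> nat \<Rightarrow> (nat \<Rightarrow> 'b) set" where
  "twisted_piece p P e = {f \<in> carrier (twisted_ring p P). \<forall>i. i \<noteq> e \<longrightarrow> f i = 0}"

text \<open>
  The left module \<open>M/N\<close>, where \<open>N \<subseteq> M\<close> are left submodules of the ring \<open>A\<close> over a subring
  of \<open>A\<close>.  The fields \<open>mult\<close> and \<open>one\<close> are part of the library's module record but are not used.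
\<close>

definition quotient_module :: "('b, 'c) ring_scheme \<Rightarrow> 'b set \<Rightarrow> 'b set \<Rightarrow> ('b, 'b set) module" where
  "quotient_module A M N =
     \<lparr>carrier = a_rcosets\<^bsub>A\<lparr>carrier := M\<rparr>\<^esub> N,
      mult = undefined,
      one = undefined,
      zero = N,
      add = set_add A,
      smult = (\<lambda>a X. \<Union>x\<in>X. N +>\<^bsub>A\<^esub> (a \<otimes>\<^bsub>A\<^esub> x))\<rparr>"

text \<open>Intended for finitely generated modules only; otherwise the value is unspecified.\<close>

definition min_num_generators :: "('b, 'c) ring_scheme \<Rightarrow> ('b, 'd, 'e) module_scheme \<Rightarrow> nat" where
  "min_num_generators R M =
     (LEAST n. \<exists>X \<subseteq> carrier M. finite X \<and> card X = n \<and>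
        (\<lambda>H. submodule H R M) hull X = carrier M)"

text \<open>
  In the following, \<open>A\<close> is a ring with graded pieces \<open>D e\<close>.  The index is shifted by one:
  \<open>G_below A D e\<close> is \<open>G\<^bsub>e-1\<^esub>(A)\<close>.
\<close>

definition G_below :: "('b, 'c) ring_scheme \<Rightarrow> (nat \<Rightarrow> 'b set) \<Rightarrow> nat \<Rightarrow> 'b set" where
  "G_below A D e = (if e = 0 then D 0 else generate_ring A (\<Union>i\<in>{..<e}. D i))"

text \<open>
  All elements of \<open>A\<^sub>e/(G\<^bsub>e-1\<^esub>(A))\<^sub>e\<close> are homogeneous (of degree \<open>e\<close>), so homogeneous generators are
  just generators.
\<close>

definition complexity :: "('b, 'c) ring_scheme \<Rightarrow> (nat \<Rightarrow> 'b set) \<Rightarrow> nat \<Rightarrow> nat" where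
  "complexity A D e =
     min_num_generators (A\<lparr>carrier := D 0\<rparr>) (quotient_module A (D e) (G_below A D e \<inter> D e))"

text \<open>
  The coefficient of \<open>T\<^sup>k\<close> in \<open>(1 + T + ... + T\<^bsup>p-1\<^esup>)\<^sup>m\<close>, which is the rank of the degree \<open>k\<close> part of
  \<open>R[x\<^sub>1,...,x\<^sub>m]/(x\<^sub>1\<^sup>p,...,x\<^sub>m\<^sup>p)\<close>.
\<close>

definition M_coeff :: "nat \<Rightarrow> nat \<Rightarrow> int \<Rightarrow> int" where
  "M_coeff p m k =
     (if k < 0 then 0 else poly.coeff ((\<Sum>i<p. Polynomial.monom 1 i) ^ m) (nat k))"

text \<open>Matrix indices start at \<open>0\<close> in the library, hence the shift by one.\<close>

definition U_mat :: "nat \<Rightarrow> nat \<Rightarrow> nat \<Rightarrow> rat mat" where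
  "U_mat p r m = mat (m - r - 1) (m - r - 1) (\<lambda>(i, j).
     of_int (M_coeff p m (int r * (int p - 1) + (int i + 1) * int p - (int j + 1))))"

text \<open>The value \<open>q(A)\<close> of a polynomial at a square matrix.\<close>

definition poly_at_mat :: "'a::comm_ring_1 poly \<Rightarrow> 'a mat \<Rightarrow> 'a mat" where
  "poly_at_mat q A = mat (dim_row A) (dim_row A) (\<lambda>(i, j).
     \<Sum>k\<le>Polynomial.degree q. poly.coeff q k * (A ^\<^sub>m k) $$ (i, j))"

definition is_minimal_poly :: "'a::field mat \<Rightarrow> 'a poly \<Rightarrow> bool" where
  "is_minimal_poly A q \<longleftrightarrow>
     Polynomial.lead_coeff q = 1 \<and>
     poly_at_mat q A = 0\<^sub>m (dim_row A) (dim_row A) \<and>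
     (\<forall>q'. q' \<noteq> 0 \<and> poly_at_mat q' A = 0\<^sub>m (dim_row A) (dim_row A)
        \<longrightarrow> Polynomial.degree q \<le> Polynomial.degree q')"

end

theory Submission
  imports Defs "Jordan_Normal_Form.Determinant"
begin

text \<open>
  Twisted multiplication maps monomials to monomials, so \<open>A\<^sub>e/(G\<^bsub>e-1\<^esub>(A))\<^sub>e\<close> is free over \<open>R\<close> on the
  monomials \<open>x\<^bsup>t\<^esup>\<close> of degree \<open>r(p\<^sup>e - 1)\<close> that are not of the form \<open>x\<^bsup>a\<^esup> * x\<^bsup>b\<^esup>\<close> with both factors of
  positive degree in \<open>A\<close>.  Writing the exponents in base \<open>p\<close>, such a \<open>t\<close> is decomposable at level \<open>i\<close> iff
  \<open>|t mod p\<^sup>i| \<le> r(p\<^sup>i - 1)\<close>.  For an indecomposable \<open>t\<close> and \<open>1 \<le> i < e\<close> the number \<open>k\<^sub>i\<close> with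
  \<open>|t mod p\<^sup>i| = r(p\<^sup>i - 1) + p\<^sup>i k\<^sub>i\<close> therefore lies in \<open>{1,...,m-r-1}\<close>, and the \<open>i\<close>-th digit vector has weight
  \<open>r(p-1) + p k\<^bsub>i+1\<^esub> - k\<^sub>i\<close>.  Hence \<open>U\<close> is the transfer matrix of the sequences \<open>k\<^sub>1, k\<^sub>2, ...\<close>, and
  \<open>c\<^sub>e = w\<^sup>T U\<^bsup>e-2\<^esup> v\<close> for \<open>e \<ge> 2\<close> with fixed vectors \<open>v\<close> and \<open>w\<close>.
\<close>

section \<open>Counting exponent vectors by a transfer matrix\<close>

definition exps :: "nat \<Rightarrow> (nat \<Rightarrow> nat) set" where
  "exps m = {t. \<forall>i. i \<notin> {1..m} \<longrightarrow> t i = 0}"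

definition wt :: "nat \<Rightarrow> (nat \<Rightarrow> nat) \<Rightarrow> nat" where
  "wt m t = (\<Sum>i=1..m. t i)"

text \<open>These are the exponents of the monomial basis of R[x_1,...,x_m]/(x_1^p,...,x_m^p), and
  also the possible vectors of base-\<open>p\<close> digits at one fixed position.\<close>

definition digit_vecs :: "nat \<Rightarrow> nat \<Rightarrow> (nat \<Rightarrow> nat) set" where
  "digit_vecs p m = {t \<in> exps m. \<forall>i\<in>{1..m}. t i < p}"

lemma finite_exps_wt: "finite {t \<in> exps m. wt m t = n}"
proof (rule finite_subset)
  show "{t \<in> exps m. wt m t = n} \<subseteq> {f. \<forall>x. (x \<in> {1..m} \<longrightarrow> f x \<in> {..n}) \<and> (x \<notin> {1..m} \<longrightarrow> f x = 0)}"
    by (auto simp: exps_def wt_def intro: member_le_sum)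
  show "finite {f. \<forall>x. (x \<in> {1..m} \<longrightarrow> f x \<in> {..n}) \<and> (x \<notin> {1..m} \<longrightarrow> f x = (0::nat))}"
    by (rule finite_set_of_finite_funs) auto
qed

text \<open>Expand the \<open>m\<close>-fold product by distributivity: each choice of one exponent
  per factor is a digit vector, and it contributes a single monomial whose exponent is its
  weight.\<close>

lemma M_coeff_eq_card:
  "M_coeff p m k = int (card {d \<in> digit_vecs p m. int (wt m d) = k})"
proof (cases "k < 0")
  case True
  then have "{d \<in> digit_vecs p m. int (wt m d) = k} = {}" by auto
  then show ?thesis using True by (simp add: M_coeff_def)
next
  case False
  have nk: "int n = k \<longleftrightarrow> n = nat k" for n using False by auto
  let ?E = "PiE {1..m} (\<lambda>_. {..<p})"
  have "(\<Sum>i<p. Polynomial.monom (1::int) i) ^ m = (\<Prod>x\<in>{1..m}. \<Sum>i\<in>{..<p}. Polynomial.monom 1 i)" by simp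
  also have "\<dots> = (\<Sum>g\<in>?E. \<Prod>x\<in>{1..m}. Polynomial.monom 1 (g x))"
    by (rule prod_sum_PiE) auto
  also have "\<dots> = (\<Sum>g\<in>?E. Polynomial.monom 1 (wt m g))"
  proof (rule sum.cong)
    fix g
    have "(\<Prod>x\<in>A. Polynomial.monom (1::int) (g x)) = Polynomial.monom 1 (\<Sum>x\<in>A. g x)" if "finite A" for A :: "nat set"
      using that by (induction) (auto simp: Polynomial.mult_monom)
    then show "(\<Prod>x\<in>{1..m}. Polynomial.monom (1::int) (g x)) = Polynomial.monom 1 (wt m g)" by (simp add: wt_def)
  qed simp
  finally have pow: "(\<Sum>i<p. Polynomial.monom (1::int) i) ^ m = (\<Sum>g\<in>?E. Polynomial.monom 1 (wt m g))" .
  have "M_coeff p m k = (\<Sum>g\<in>?E. if wt m g = nat k then 1 else 0)"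
    using False by (simp only: M_coeff_def pow Polynomial.coeff_sum Polynomial.coeff_monom if_False)
  also have "\<dots> = int (card {g \<in> ?E. wt m g = nat k})"
    by (subst sum.inter_filter[symmetric]) (simp_all add: finite_PiE)
  also have "card {g \<in> ?E. wt m g = nat k} = card {d \<in> digit_vecs p m. int (wt m d) = k}"
    unfolding nk
  proof (rule bij_betw_same_card)
    \<comment> \<open>Elements of \<open>?E\<close> are \<open>undefined\<close> outside
      \<open>{1..m}\<close>, digit vectors are 0 there; \<open>?f\<close> and \<open>?h\<close> only
      exchange these default values.\<close>
    let ?f = "\<lambda>g i. if i \<in> {1..m} then g i else (0::nat)"
    let ?h = "\<lambda>g. restrict g {1..m}"
    show "bij_betw ?f {g \<in> ?E. wt m g = nat k} {d \<in> digit_vecs p m. wt m d = nat k}"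
    proof (rule bij_betw_byWitness[where f' = ?h])
      show "\<forall>g\<in>{g \<in> ?E. wt m g = nat k}. ?h (?f g) = g"
        by (auto simp: fun_eq_iff PiE_iff extensional_def)
      show "\<forall>d\<in>{d \<in> digit_vecs p m. wt m d = nat k}. ?f (?h d) = d"
        by (auto simp: fun_eq_iff digit_vecs_def exps_def)
      show "?f ` {g \<in> ?E. wt m g = nat k} \<subseteq> {d \<in> digit_vecs p m. wt m d = nat k}"
        by (auto simp: digit_vecs_def exps_def wt_def PiE_iff)
      show "?h ` {d \<in> digit_vecs p m. wt m d = nat k} \<subseteq> {g \<in> ?E. wt m g = nat k}"
        by (auto simp: digit_vecs_def exps_def wt_def)
    qed
  qed
  finally show ?thesis .
qed

section \<open>Splitting an exponent vector into low and high part\<close>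

text \<open>
  The set \<open>H\<close> restricts what remains after the \<open>n\<close> lowest digits: \<open>digit_vecs p m\<close> gives the truncations
  in state \<open>k\<close>, while \<open>H = exps m\<close>, \<open>k = 0\<close> gives the indecomposable exponents of degree \<open>r(p\<^bsup>n+1\<^esup> - 1)\<close>.
\<close>

definition heavy_exps :: "nat \<Rightarrow> nat \<Rightarrow> nat \<Rightarrow> nat \<Rightarrow> (nat \<Rightarrow> nat) set \<Rightarrow> int \<Rightarrow> (nat \<Rightarrow> nat) set" where
  "heavy_exps p r m n H k = {t \<in> exps m. (\<lambda>i. t i div p ^ n) \<in> H \<and>
     int (wt m t) = int r * (int p ^ Suc n - 1) + int p ^ Suc n * k \<and>
     (\<forall>e\<in>{1..n}. r * (p ^ e - 1) < wt m (\<lambda>i. t i mod p ^ e))}"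

lemma finite_heavy_exps: "finite (heavy_exps p r m n H k)"
  by (rule finite_subset[OF _ finite_exps_wt[of m "nat (int r * (int p ^ Suc n - 1) + int p ^ Suc n * k)"]])
     (auto simp: heavy_exps_def)

lemma wt_mod_div:
  "wt m t = wt m (\<lambda>i. t i mod q) + q * wt m (\<lambda>i. t i div q)"
  by (simp add: wt_def sum_distrib_left flip: sum.distrib)

lemma mod_div_exps: "t \<in> exps m \<Longrightarrow> (\<lambda>i. t i mod q) \<in> exps m" "t \<in> exps m \<Longrightarrow> (\<lambda>i. t i div q) \<in> exps m"
  by (auto simp: exps_def)

lemma wt_digits_le:
  assumes "\<And>i. i \<in> {1..m} \<Longrightarrow> t i < q"
  shows "int (wt m t) \<le> int m * (int q - 1)"
proof -
  have "int (wt m t) = (\<Sum>i=1..m. int (t i))" by (simp add: wt_def)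
  also have "\<dots> \<le> (\<Sum>i=1..m. int q - 1)" using assms by (intro sum_mono) fastforce
  finally show ?thesis by simp
qed

text \<open>Cut \<open>t\<close> at \<open>Q = p ^ Suc n\<close>. The state \<open>k\<close> is the
  excess of the low weight over \<open>r * (Q - 1)\<close> in units of \<open>Q\<close>. Heaviness
  at level \<open>Suc n\<close> says \<open>k > 0\<close>; since \<open>m\<close> entries below
  \<open>Q\<close> weigh at most \<open>m * (Q - 1)\<close>, also \<open>k < m - r\<close>.\<close>

lemma heavy_exps_Suc_iff:
  fixes p :: nat
  assumes p: "p \<ge> 2" and H: "H \<subseteq> exps m" and t: "t \<in> exps m"
  shows "t \<in> heavy_exps p r m (Suc n) H k' \<longleftrightarrow>
     (\<exists>k\<in>{1..<int m - int r}. (\<lambda>i. t i mod p ^ Suc n) \<in> heavy_exps p r m n (digit_vecs p m) k \<and>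
       (\<lambda>i. t i div p ^ Suc n) \<in> {h \<in> H. int (wt m h) = int r * (int p - 1) + int p * k' - k})"
   (is "?L \<longleftrightarrow> (\<exists>k\<in>?K. ?A k \<and> ?B k)")
proof -
  define Q where "Q = p ^ Suc n"
  define l where "l = (\<lambda>i. t i mod Q)"
  define h where "h = (\<lambda>i. t i div Q)"
  have Q: "Q \<ge> 1" "int Q > 0" using p by (auto simp: Q_def)
  have l: "l \<in> exps m" and h: "h \<in> exps m" using t by (auto simp: l_def h_def mod_div_exps)
  have wt: "int (wt m t) = int (wt m l) + int Q * int (wt m h)"
    unfolding l_def h_def by (subst wt_mod_div[of m t Q]) simp
  have ldig: "(\<lambda>i. l i div p ^ n) \<in> digit_vecs p m"
    using mod_div_exps(2)[OF l] p
    by (auto simp: digit_vecs_def l_def Q_def less_mult_imp_div_less mult.commute)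
  have lmod: "(\<lambda>i. l i mod p ^ e) = (\<lambda>i. t i mod p ^ e)" if "e \<le> Suc n" for e
    using that by (auto simp: l_def Q_def le_imp_power_dvd mod_mod_cancel simp del: power_Suc)
  have l_le: "int (wt m l) \<le> int m * (int Q - 1)"
    by (rule wt_digits_le) (use Q in \<open>auto simp: l_def\<close>)
  \<comment> \<open>Up to level \<open>n\<close>, truncating \<open>l\<close> or \<open>t\<close>
    gives the same vector, so these conditions pass unchanged between them.\<close>
  have A: "?A k \<longleftrightarrow> int (wt m l) = int r * (int Q - 1) + int Q * k \<and>
       (\<forall>e\<in>{1..n}. r * (p ^ e - 1) < wt m (\<lambda>i. t i mod p ^ e))" for k
    using l ldig lmod by (simp add: heavy_exps_def Q_def[symmetric] flip: of_nat_power l_def del: power_Suc)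
  \<comment> \<open>The condition at level \<open>Suc n\<close> is separated from the others: it is
    the one that becomes \<open>k > 0\<close>.\<close>
  have LL: "?L \<longleftrightarrow> h \<in> H \<and> int (wt m t) = int r * (int p * int Q - 1) + int p * int Q * k' \<and>
       (\<forall>e\<in>{1..n}. r * (p ^ e - 1) < wt m (\<lambda>i. t i mod p ^ e)) \<and> r * (Q - 1) < wt m l"
    using t unfolding heavy_exps_def h_def l_def Q_def by (auto simp: atLeastAtMostSuc_conv)
  have B: "?B k \<longleftrightarrow> h \<in> H \<and> int (wt m h) = int r * (int p - 1) + int p * k' - k" for k
    by (simp add: h_def Q_def)
  show ?thesis
  proof
    assume L: ?L
    \<comment> \<open>\<open>k\<close> is read off from the high part, so that \<open>?B k\<close>
      holds by choice; subtracting \<open>Q * wt m h\<close> from the total weight then yields the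
      weight of \<open>l\<close>.\<close>
    define k where "k = int r * (int p - 1) + int p * k' - int (wt m h)"
    have e: "int (wt m l) = int r * (int Q - 1) + int Q * k"
      using L wt unfolding LL k_def by (simp add: algebra_simps)
    have "int (r * (Q - 1)) < int (wt m l)" using L LL by linarith
    then have "int r * (int Q - 1) < int (wt m l)" using Q by (simp add: of_nat_diff)
    then have "int Q * k > 0" using e by linarith
    then have k1: "k \<ge> 1" using Q by (simp add: zero_less_mult_iff)
    have "int Q * k \<le> (int m - int r) * (int Q - 1)" using e l_le by (simp add: algebra_simps)
    \<comment> \<open>Passing from \<open>(m - r) * (Q - 1)\<close> to the strict bound
      \<open>Q * (m - r)\<close> needs \<open>m - r\<close> positive; this is forced by
      \<open>Q * k > 0\<close>.\<close>
    moreover have "int m - int r > 0"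
    proof (rule ccontr)
      assume "\<not> ?thesis"
      then have "(int m - int r) * (int Q - 1) \<le> 0" using Q by (intro mult_nonpos_nonneg) auto
      then show False using calculation \<open>int Q * k > 0\<close> by linarith
    qed
    ultimately have "int Q * k < int Q * (int m - int r)" by (simp add: algebra_simps)
    then have "k < int m - int r" using Q by simp
    then have "k \<in> ?K" using k1 by simp
    moreover have "?A k" using A e L LL by blast
    moreover have "?B k" unfolding B using L LL k_def by simp
    ultimately show "\<exists>k\<in>?K. ?A k \<and> ?B k" by blast
  next
    assume "\<exists>k\<in>?K. ?A k \<and> ?B k"
    then obtain k where k: "k \<in> ?K" "?A k" "?B k" by blast
    have e: "int (wt m l) = int r * (int Q - 1) + int Q * k" using A k by blast
    have "int Q * k > 0" using k(1) Q by simp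
    then have "int (r * (Q - 1)) < int (wt m l)" using e Q by (simp add: of_nat_diff)
    then have "r * (Q - 1) < wt m l" by (rule of_nat_less_imp_less)
    moreover have "int (wt m t) = int r * (int p * int Q - 1) + int p * int Q * k'"
    proof -
      have h_eq: "int (wt m h) = int r * (int p - 1) + int p * k' - k" using k(3) B by blast
      show ?thesis unfolding wt e h_eq by (simp add: algebra_simps)
    qed
    moreover have "h \<in> H" "\<forall>e\<in>{1..n}. r * (p ^ e - 1) < wt m (\<lambda>i. t i mod p ^ e)"
      using k(2,3) A B by blast+
    ultimately show ?L unfolding LL by blast
  qed
qed

text \<open>Low and high part determine \<open>t\<close>, and any pair with matching state can be
  glued, so the count is a sum over states of products.\<close>

lemma card_heavy_exps_Suc:
  fixes p :: nat
  assumes p: "p \<ge> 2" and H: "H \<subseteq> exps m"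
  shows "card (heavy_exps p r m (Suc n) H k') = (\<Sum>k\<in>{1..<int m - int r}.
     card (heavy_exps p r m n (digit_vecs p m) k) *
     card {h \<in> H. int (wt m h) = int r * (int p - 1) + int p * k' - k})"
proof -
  define Q where "Q = p ^ Suc n"
  define C where "C k = heavy_exps p r m n (digit_vecs p m) k" for k
  define F where "F k = {h \<in> H. int (wt m h) = int r * (int p - 1) + int p * k' - k}" for k
  have Q: "Q > 0" using p by (auto simp: Q_def)
  have finF: "finite (F k)" for k
    by (rule finite_subset[OF _ finite_exps_wt[of m "nat (int r * (int p - 1) + int p * k' - k)"]])
       (use H in \<open>auto simp: F_def\<close>)
  \<comment> \<open>The top digit of a low part is below \<open>p\<close>, hence all its entries are
    below \<open>Q\<close>; so \<open>l + Q * h\<close> has remainder \<open>l\<close> and quotient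
    \<open>h\<close>.\<close>
  have lt: "l i < Q" if "l \<in> C k" for l k i
  proof -
    have "l i div p ^ n < p"
      using that p by (cases "i \<in> {1..m}") (auto simp: C_def heavy_exps_def digit_vecs_def exps_def)
    then show ?thesis using p by (simp add: Q_def div_less_iff_less_mult mult.commute)
  qed
  let ?Y = "\<Union>k\<in>{1..<int m - int r}. C k \<times> F k"
  let ?f = "\<lambda>t. ((\<lambda>i. t i mod Q), (\<lambda>i. t i div Q))"
  let ?g = "\<lambda>(l, h) i. l i + Q * h i"
  have inv: "(\<lambda>i. ?g (l, h) i mod Q) = l" "(\<lambda>i. ?g (l, h) i div Q) = h" if "l \<in> C k" for l h k
    using lt[OF that] Q by (auto simp: fun_eq_iff)
  have "bij_betw ?f (heavy_exps p r m (Suc n) H k') ?Y"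
  proof (rule bij_betw_byWitness[where f' = ?g])
    show "\<forall>a\<in>heavy_exps p r m (Suc n) H k'. ?g (?f a) = a" by auto
    show "\<forall>a'\<in>?Y. ?f (?g a') = a'"
    proof
      fix a' assume "a' \<in> ?Y"
      then obtain k l h where "l \<in> C k" "a' = (l, h)" by blast
      then show "?f (?g a') = a'" using inv[of l k h] by simp
    qed
    show "?f ` heavy_exps p r m (Suc n) H k' \<subseteq> ?Y"
    proof
      fix y assume "y \<in> ?f ` heavy_exps p r m (Suc n) H k'"
      then obtain t where t: "t \<in> heavy_exps p r m (Suc n) H k'" "y = ?f t" by blast
      then have "t \<in> exps m" by (simp add: heavy_exps_def)
      from heavy_exps_Suc_iff[OF p H this] t show "y \<in> ?Y"
        by (auto simp: C_def F_def Q_def)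
    qed
    show "?g ` ?Y \<subseteq> heavy_exps p r m (Suc n) H k'"
    proof
      fix t assume "t \<in> ?g ` ?Y"
      then obtain k l h where k: "k \<in> {1..<int m - int r}" "l \<in> C k" "h \<in> F k" and tt: "t = ?g (l, h)"
        by blast
      have "t \<in> exps m" using k H by (auto simp: tt C_def F_def heavy_exps_def exps_def)
      from heavy_exps_Suc_iff[OF p H this] show "t \<in> heavy_exps p r m (Suc n) H k'"
        using k inv[OF k(2), of h, folded tt] by (auto simp: C_def F_def Q_def)
    qed
  qed
  then have "card (heavy_exps p r m (Suc n) H k') = card ?Y" by (rule bij_betw_same_card)
  also have "\<dots> = (\<Sum>k\<in>{1..<int m - int r}. card (C k \<times> F k))"
  proof (rule card_UN_disjoint)
    show "\<forall>k\<in>{1..<int m - int r}. finite (C k \<times> F k)" using finF by (auto simp: C_def finite_heavy_exps)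
    \<comment> \<open>The weight of a low part determines its state.\<close>
    have "C k \<inter> C k2 = {}" if "k \<noteq> k2" for k k2
      using that p by (auto simp: C_def heavy_exps_def)
    then show "\<forall>i\<in>{1..<int m - int r}. \<forall>j\<in>{1..<int m - int r}. i \<noteq> j \<longrightarrow> C i \<times> F i \<inter> C j \<times> F j = {}"
      by blast
  qed simp
  finally show ?thesis by (simp add: C_def F_def card_cartesian_product)
qed

section \<open>State vectors and powers of \<open>U_mat\<close>\<close>

definition heavy_vec :: "nat \<Rightarrow> nat \<Rightarrow> nat \<Rightarrow> nat \<Rightarrow> rat vec" where
  "heavy_vec p r m n =
     vec (m - r - 1) (\<lambda>i. of_nat (card (heavy_exps p r m n (digit_vecs p m) (int i + 1))))"

lemma sum_int_shift:
  "(\<Sum>k\<in>{1..<int m - int r}. f k) = (\<Sum>j<m - r - 1. f (int j + 1))"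
proof (rule sum.reindex_bij_witness)
  show "\<And>a. a \<in> {1..<int m - int r} \<Longrightarrow> int (nat (a - 1)) + 1 = a" by auto
  show "\<And>a. a \<in> {1..<int m - int r} \<Longrightarrow> nat (a - 1) \<in> {..<m - r - 1}" by auto
qed auto

text \<open>By \<open>M_coeff_eq_card\<close> the number of digit vectors leading from state
  \<open>j + 1\<close> to state \<open>i + 1\<close> is the entry \<open>(i, j)\<close> of
  \<open>U_mat\<close>: old states index columns, new states rows.\<close>

lemma heavy_vec_Suc:
  assumes "p \<ge> 2"
  shows "heavy_vec p r m (Suc n) = U_mat p r m *\<^sub>v heavy_vec p r m n"
proof (rule eq_vecI)
  fix i assume "i < dim_vec (U_mat p r m *\<^sub>v heavy_vec p r m n)"
  then have i: "i < m - r - 1" by (simp add: U_mat_def)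
  have D: "digit_vecs p m \<subseteq> exps m" by (auto simp: digit_vecs_def)
  have "heavy_vec p r m (Suc n) $ i = (\<Sum>j<m - r - 1.
      of_nat (card (heavy_exps p r m n (digit_vecs p m) (int j + 1))) *
      of_nat (card {h \<in> digit_vecs p m. int (wt m h) = int r * (int p - 1) + int p * (int i + 1) - (int j + 1)}))"
    using i by (simp only: heavy_vec_def index_vec card_heavy_exps_Suc[OF assms D] sum_int_shift of_nat_sum of_nat_mult)
  also have "\<dots> = (\<Sum>j<m - r - 1. U_mat p r m $$ (i, j) * heavy_vec p r m n $ j)"
    using i by (intro sum.cong) (auto simp: U_mat_def heavy_vec_def M_coeff_eq_card mult.commute)
  also have "\<dots> = (U_mat p r m *\<^sub>v heavy_vec p r m n) $ i"
    using i by (simp add: scalar_prod_def U_mat_def heavy_vec_def atLeast0LessThan)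
  finally show "heavy_vec p r m (Suc n) $ i = (U_mat p r m *\<^sub>v heavy_vec p r m n) $ i" .
qed (simp add: heavy_vec_def U_mat_def)

lemma heavy_vec_add:
  assumes "p \<ge> 2"
  shows "heavy_vec p r m (n + k) = U_mat p r m ^\<^sub>m k *\<^sub>v heavy_vec p r m n"
proof (induction k arbitrary: n)
  case (Suc k)
  have U: "U_mat p r m \<in> carrier_mat (m - r - 1) (m - r - 1)" by (simp add: U_mat_def)
  have v: "heavy_vec p r m n \<in> carrier_vec (m - r - 1)" by (simp add: heavy_vec_def)
  have "heavy_vec p r m (n + Suc k) = U_mat p r m ^\<^sub>m k *\<^sub>v (U_mat p r m *\<^sub>v heavy_vec p r m n)"
    using Suc[of "Suc n"] by (simp add: heavy_vec_Suc[OF assms])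
  also have "\<dots> = U_mat p r m ^\<^sub>m Suc k *\<^sub>v heavy_vec p r m n"
    using assoc_mult_mat_vec[OF pow_carrier_mat[OF U] U v] by simp
  finally show ?case .
qed (simp add: U_mat_def heavy_vec_def)

text \<open>The counts are one fixed linear functional applied to \<open>U^k v\<close> with
  \<open>v = heavy_vec p r m n\<close>. Combined with the coefficients of \<open>q\<close> they give
  that functional at \<open>q(U) v = 0\<close>.\<close>

lemma heavy_exps_recurrence:
  assumes p: "p \<ge> 2" and q: "poly_at_mat q (U_mat p r m) = 0\<^sub>m (dim_row (U_mat p r m)) (dim_row (U_mat p r m))"
  shows "(\<Sum>k\<le>Polynomial.degree q. poly.coeff q k * of_nat (card (heavy_exps p r m (Suc (n + k)) (exps m) 0))) = 0"
proof -
  define d where "d = m - r - 1"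
  define U where "U = U_mat p r m"
  \<comment> \<open>\<open>w\<close> closes a sequence of states: the last high part may have
    entries of any size, and it must lead to state 0, that is, to the exact total degree.\<close>
  define w where "w j = (of_nat (card {h \<in> exps m.
      int (wt m h) = int r * (int p - 1) + int p * 0 - (int j + 1)}) :: rat)" for j
  have [simp]: "dim_row (U ^\<^sub>m k) = d" "dim_col (U ^\<^sub>m k) = d" "dim_row U = d" "dim_col U = d" for k
    using pow_carrier_mat[of U d k] by (auto simp: U_def U_mat_def d_def)
  have [simp]: "dim_vec (heavy_vec p r m n) = d" for n by (simp add: heavy_vec_def d_def)
  have card: "of_nat (card (heavy_exps p r m (Suc n) (exps m) 0)) = (\<Sum>j<d. heavy_vec p r m n $ j * w j)" for n
    by (simp add: card_heavy_exps_Suc[OF p subset_refl] sum_int_shift heavy_vec_def w_def d_def)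
  have vec: "heavy_vec p r m (n + k) $ j = (\<Sum>i<d. (U ^\<^sub>m k) $$ (j, i) * heavy_vec p r m n $ i)"
    if "j < d" for j k
  proof -
    have "heavy_vec p r m (n + k) $ j = (U ^\<^sub>m k *\<^sub>v heavy_vec p r m n) $ j"
      by (simp add: heavy_vec_add[OF p] U_def)
    also have "\<dots> = (\<Sum>i<d. (U ^\<^sub>m k) $$ (j, i) * heavy_vec p r m n $ i)"
      using that by (auto simp: scalar_prod_def atLeast0LessThan intro!: sum.cong)
    finally show ?thesis .
  qed
  have zero: "(\<Sum>k\<le>Polynomial.degree q. poly.coeff q k * (U ^\<^sub>m k) $$ (j, i)) = 0" if "j < d" "i < d" for i j
  proof -
    have "poly_at_mat q U $$ (j, i) = 0" using q that by (simp add: U_def[symmetric])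
    then show ?thesis using that by (simp add: poly_at_mat_def)
  qed
  have "(\<Sum>k\<le>Polynomial.degree q. poly.coeff q k * of_nat (card (heavy_exps p r m (Suc (n + k)) (exps m) 0)))
      = (\<Sum>k\<le>Polynomial.degree q. \<Sum>j<d. \<Sum>i<d. poly.coeff q k * (U ^\<^sub>m k) $$ (j, i) * (heavy_vec p r m n $ i * w j))"
    by (simp add: card vec sum_distrib_left sum_distrib_right mult_ac)
  \<comment> \<open>The sum over \<open>k\<close> moves innermost, where it is an entry of
    \<open>q(U)\<close>.\<close>
  also have "\<dots> = (\<Sum>j<d. \<Sum>i<d. (\<Sum>k\<le>Polynomial.degree q. poly.coeff q k * (U ^\<^sub>m k) $$ (j, i)) * (heavy_vec p r m n $ i * w j))"
    by (subst sum.swap, rule sum.cong[OF refl], subst sum.swap) (simp add: sum_distrib_right)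
  also have "\<dots> = 0" by (simp add: zero)
  finally show ?thesis .
qed

section \<open>Indecomposable monomials\<close>

text \<open>Raising entries one unit at a time from 0, every weight up to \<open>wt m h\<close> is
  reached below \<open>h\<close>.\<close>

lemma exps_below:
  assumes "h \<in> exps m" "n \<le> wt m h"
  obtains u where "u \<in> exps m" "\<And>i. u i \<le> h i" "wt m u = n"
proof -
  have "\<exists>u. (\<forall>i. u i \<le> h i) \<and> sum u {1..m} = n" if "n \<le> wt m h" for n
    using that
  proof (induction n)
    case 0
    show ?case by (intro exI[of _ "\<lambda>_. 0"]) auto
  next
    case (Suc n)
    then obtain u where u: "\<forall>i. u i \<le> h i" "sum u {1..m} = n" by auto
    have "\<not> (\<forall>i\<in>{1..m}. h i \<le> u i)"
    proof
      assume "\<forall>i\<in>{1..m}. h i \<le> u i"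
      then have "wt m h \<le> sum u {1..m}" unfolding wt_def by (intro sum_mono) auto
      then show False using u Suc.prems by simp
    qed
    then obtain j where j: "j \<in> {1..m}" "u j < h j" by (auto simp: not_le)
    have "sum (u(j := Suc (u j))) {1..m} = Suc n"
    proof -
      have "sum (u(j := Suc (u j))) {1..m} = (\<Sum>i=1..m. u i + (if i = j then 1 else 0))"
        by (rule sum.cong) auto
      then show ?thesis using u(2) j(1) by (simp add: sum.distrib)
    qed
    then show ?case using u j by (intro exI[of _ "u(j := Suc (u j))"]) auto
  qed
  from this[OF assms(2)] obtain u where "\<forall>i. u i \<le> h i" "sum u {1..m} = n" by blast
  moreover have "u i = 0" if "i \<notin> {1..m}" for i
    using that assms(1) calculation(1)[rule_format, of i] by (simp add: exps_def)
  then have "u \<in> exps m" by (simp add: exps_def)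
  ultimately show ?thesis using that by (auto simp: wt_def)
qed

text \<open>In a decomposition, \<open>a\<close> dominates the low part of \<open>t\<close>, since
  \<open>p ^ i * b\<close> vanishes modulo \<open>p ^ i\<close>. Conversely, a light low part leaves
  enough weight in the high part to choose \<open>b\<close> there, and \<open>a\<close> takes the
  rest.\<close>

lemma decomposable_iff:
  fixes p :: nat
  assumes p: "p > 0" and t: "t \<in> exps m" "wt m t = r * (p ^ e - 1)" and i: "i \<le> e"
  shows "(\<exists>a\<in>exps m. \<exists>b\<in>exps m. wt m a = r * (p ^ i - 1) \<and> wt m b = r * (p ^ (e - i) - 1) \<and>
            t = (\<lambda>x. a x + p ^ i * b x)) \<longleftrightarrow>
         wt m (\<lambda>x. t x mod p ^ i) \<le> r * (p ^ i - 1)" (is "?L \<longleftrightarrow> ?R")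
proof
  assume ?L
  then obtain a b where a: "wt m a = r * (p ^ i - 1)" and t: "t = (\<lambda>x. a x + p ^ i * b x)" by blast
  have "wt m (\<lambda>x. t x mod p ^ i) \<le> wt m a" unfolding wt_def t by (intro sum_mono) simp
  then show ?R using a by simp
next
  assume R: ?R
  define Q where "Q = p ^ i"
  define n where "n = r * (p ^ (e - i) - 1)"
  define h where "h = (\<lambda>x. t x div Q)"
  have Q: "Q > 0" using p by (simp add: Q_def)
  have pe: "p ^ e = Q * p ^ (e - i)" using i by (simp add: Q_def flip: power_add)
  have e: "r * (p ^ e - 1) = r * (Q - 1) + Q * n"
  proof -
    have "p ^ e - 1 = (Q - 1) + Q * (p ^ (e - i) - 1)"
      using p Q by (simp add: pe diff_mult_distrib2)
    then show ?thesis unfolding n_def by (simp add: algebra_simps)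
  qed
  \<comment> \<open>Of the total \<open>r * (Q - 1) + Q * n\<close>, the low part carries at most
    \<open>r * (Q - 1)\<close>.\<close>
  have "Q * n \<le> Q * wt m h"
    using wt_mod_div[of m t Q] R t(2) e unfolding h_def[symmetric] Q_def[symmetric] by linarith
  then have "n \<le> wt m h" using Q by simp
  moreover have "h \<in> exps m" using t(1) by (simp add: h_def mod_div_exps)
  ultimately obtain b where b: "b \<in> exps m" "\<And>x. b x \<le> h x" "wt m b = n" using exps_below by metis
  \<comment> \<open>\<open>a\<close> keeps the low part and the multiples of \<open>Q\<close> not
    taken by \<open>b\<close>; its weight is then forced.\<close>
  define a where "a = (\<lambda>x. t x - Q * b x)"
  have "Q * b x \<le> t x" for x
    using mult_le_mono2[OF b(2)[of x], of Q] times_div_less_eq_dividend[of Q "t x"] unfolding h_def by linarith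
  then have ta: "t = (\<lambda>x. a x + Q * b x)" by (simp add: a_def)
  have "wt m t = wt m a + Q * wt m b"
    unfolding wt_def by (subst ta) (simp add: sum.distrib sum_distrib_left)
  then have "wt m a = r * (Q - 1)" using t(2) e b(3) by simp
  moreover have "a \<in> exps m" using t(1) by (simp add: a_def exps_def)
  ultimately show ?L using b ta unfolding Q_def n_def by blast
qed

section \<open>Monomials as finitely supported exponents\<close>

definition monomials :: "nat \<Rightarrow> nat \<Rightarrow> (nat \<Rightarrow>\<^sub>0 nat) set" where
  "monomials m n = {t. Poly_Mapping.lookup t \<in> exps m \<and> wt m (Poly_Mapping.lookup t) = n}"

text \<open>The exponent of the \<open>q\<close>-th power of the monomial with exponent
  \<open>t\<close>, as a repeated sum in the monoid of exponents.\<close>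

definition exp_scale :: "nat \<Rightarrow> (nat \<Rightarrow>\<^sub>0 nat) \<Rightarrow> (nat \<Rightarrow>\<^sub>0 nat)" where
  "exp_scale q t = (\<Sum>_<q. t)"

lemma lookup_exp_scale [simp]: "Poly_Mapping.lookup (exp_scale q t) = (\<lambda>i. q * Poly_Mapping.lookup t i)"
  unfolding exp_scale_def fun_eq_iff lookup_sum by simp

lemma poly_piece_eq: "poly_piece m k = {f. Poly_Mapping.keys f \<subseteq> monomials m k}"
proof -
  have "Poly_Mapping.keys t \<subseteq> {1..m} \<longleftrightarrow> Poly_Mapping.lookup t \<in> exps m" for t :: "nat \<Rightarrow>\<^sub>0 nat"
    by (auto simp: exps_def in_keys_iff subset_iff)
  then show ?thesis by (auto simp: poly_piece_def monomials_def wt_def)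
qed

lemma exps_lookup_surj:
  assumes "f \<in> exps m"
  obtains t where "Poly_Mapping.lookup t = f"
proof -
  have "finite {i. f i \<noteq> 0}"
    by (rule finite_subset[of _ "{1..m}"]) (use assms in \<open>auto simp: exps_def\<close>)
  then show ?thesis using that lookup_Abs_poly_mapping by blast
qed

lemma bij_betw_lookup_monomials:
  "bij_betw Poly_Mapping.lookup (monomials m n) {f \<in> exps m. wt m f = n}"
  unfolding bij_betw_def
proof
  show "inj_on Poly_Mapping.lookup (monomials m n)" by (auto intro: inj_onI poly_mapping_eqI)
  show "Poly_Mapping.lookup ` monomials m n = {f \<in> exps m. wt m f = n}"
    by (auto simp: monomials_def image_iff) (metis exps_lookup_surj)
qed

lemma finite_monomials: "finite (monomials m n)"
  using bij_betw_finite[OF bij_betw_lookup_monomials] finite_exps_wt by blast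

lemma monomials_0: "monomials m 0 = {0}"
proof -
  have "Poly_Mapping.lookup t = (\<lambda>_. 0)" if "t \<in> monomials m 0" for t
    using that unfolding monomials_def exps_def wt_def fun_eq_iff by auto
  then show ?thesis
    by (auto simp: monomials_def exps_def wt_def intro!: poly_mapping_eqI)
qed

text \<open>The twisted product respects degrees because p^(i+j) - 1 = (p^i - 1) + p^i (p^j -
  1).\<close>

lemma monomials_add_exp_scale:
  assumes "a \<in> monomials m (r * (p ^ i - 1))" "b \<in> monomials m (r * (p ^ j - 1))" and p: "p > 0"
  shows "a + exp_scale (p ^ i) b \<in> monomials m (r * (p ^ (i + j) - 1))"
proof -
  have "p ^ (i + j) - 1 = (p ^ i - 1) + p ^ i * (p ^ j - 1)"
    using p by (simp add: power_add diff_mult_distrib2)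
  then have "r * (p ^ (i + j) - 1) = r * (p ^ i - 1) + p ^ i * (r * (p ^ j - 1))"
    by (simp add: algebra_simps)
  then show ?thesis using assms
    by (auto simp: monomials_def exps_def wt_def lookup_add sum.distrib simp flip: sum_distrib_left)
qed

text \<open>Exponents of twisted products of monomials of degrees \<open>i\<close> and
  \<open>e - i\<close>; the range of \<open>i\<close> excludes the scalar factors of degree
  0.\<close>

definition decomposables :: "nat \<Rightarrow> nat \<Rightarrow> nat \<Rightarrow> nat \<Rightarrow> (nat \<Rightarrow>\<^sub>0 nat) set" where
  "decomposables p r m e = (\<Union>i\<in>{1..<e}. {a + exp_scale (p ^ i) b | a b.
     a \<in> monomials m (r * (p ^ i - 1)) \<and> b \<in> monomials m (r * (p ^ (e - i) - 1))})"

text \<open>In degree \<open>Suc n\<close> the possible cuts are the levels 1 to \<open>n\<close>;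
  by \<open>decomposable_iff\<close>, failure of all of them is exactly the list of strict
  inequalities in \<open>heavy_exps\<close>.\<close>

lemma card_indecomposables:
  fixes p :: nat
  assumes p: "p > 0"
  shows "card (monomials m (r * (p ^ Suc n - 1)) - decomposables p r m (Suc n)) =
    card (heavy_exps p r m n (exps m) 0)"
proof -
  let ?T = "{f \<in> exps m. wt m f = r * (p ^ Suc n - 1)}"
  define D where "D i t \<longleftrightarrow> (\<exists>a\<in>exps m. \<exists>b\<in>exps m. wt m a = r * (p ^ i - 1) \<and>
      wt m b = r * (p ^ (Suc n - i) - 1) \<and> t = (\<lambda>x. a x + p ^ i * b x))" for i t
  have dec: "t \<in> decomposables p r m (Suc n) \<longleftrightarrow> (\<exists>i\<in>{1..<Suc n}. D i (Poly_Mapping.lookup t))" for t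
  proof -
    have "(\<exists>a\<in>monomials m k. \<exists>b\<in>monomials m l. t = a + exp_scale q b) \<longleftrightarrow>
       (\<exists>a\<in>exps m. \<exists>b\<in>exps m. wt m a = k \<and> wt m b = l \<and> Poly_Mapping.lookup t = (\<lambda>x. a x + q * b x))" for k l q
    proof
      assume "\<exists>a\<in>monomials m k. \<exists>b\<in>monomials m l. t = a + exp_scale q b"
      then show "\<exists>a\<in>exps m. \<exists>b\<in>exps m. wt m a = k \<and> wt m b = l \<and> Poly_Mapping.lookup t = (\<lambda>x. a x + q * b x)"
        by (fastforce simp: monomials_def lookup_add fun_eq_iff)
    next
      assume "\<exists>a\<in>exps m. \<exists>b\<in>exps m. wt m a = k \<and> wt m b = l \<and> Poly_Mapping.lookup t = (\<lambda>x. a x + q * b x)"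
      then obtain a b where ab: "a \<in> exps m" "b \<in> exps m" "wt m a = k" "wt m b = l"
        "Poly_Mapping.lookup t = (\<lambda>x. a x + q * b x)" by blast
      obtain a' b' where "Poly_Mapping.lookup a' = a" "Poly_Mapping.lookup b' = b"
        using ab exps_lookup_surj by metis
      then show "\<exists>a\<in>monomials m k. \<exists>b\<in>monomials m l. t = a + exp_scale q b"
        using ab by (intro bexI[of _ a'] bexI[of _ b'] poly_mapping_eqI) (auto simp: monomials_def lookup_add)
    qed
    note this[of "r * (p ^ i - 1)" "r * (p ^ (Suc n - i) - 1)" "p ^ i" for i]
    then show ?thesis unfolding decomposables_def D_def by blast
  qed
  have "card (monomials m (r * (p ^ Suc n - 1)) - decomposables p r m (Suc n)) =
      card {t \<in> ?T. \<forall>i\<in>{1..<Suc n}. \<not> D i t}"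
  proof (rule bij_betw_same_card[of Poly_Mapping.lookup])
    have eq: "monomials m (r * (p ^ Suc n - 1)) - decomposables p r m (Suc n) =
      {t \<in> monomials m (r * (p ^ Suc n - 1)). \<forall>i\<in>{1..<Suc n}. \<not> D i (Poly_Mapping.lookup t)}"
      using dec by blast
    show "bij_betw Poly_Mapping.lookup
      (monomials m (r * (p ^ Suc n - 1)) - decomposables p r m (Suc n)) {t \<in> ?T. \<forall>i\<in>{1..<Suc n}. \<not> D i t}"
      unfolding eq by (rule bij_betw_Collect[OF bij_betw_lookup_monomials]) simp
  qed
  also have "{t \<in> ?T. \<forall>i\<in>{1..<Suc n}. \<not> D i t} =
      {t \<in> ?T. \<forall>i\<in>{1..n}. r * (p ^ i - 1) < wt m (\<lambda>x. t x mod p ^ i)}"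
  proof -
    have "\<not> D i t \<longleftrightarrow> r * (p ^ i - 1) < wt m (\<lambda>x. t x mod p ^ i)" if "t \<in> ?T" "i \<in> {1..n}" for t i
      using decomposable_iff[OF p, of t m r "Suc n" i] that unfolding D_def by auto
    moreover have "{1..<Suc n} = {1..n}" by auto
    ultimately show ?thesis by blast
  qed
  \<comment> \<open>In state 0 the integer weight equation is the exact degree, and for
    \<open>H = exps m\<close> the condition on the high part holds automatically.\<close>
  also have "\<dots> = heavy_exps p r m n (exps m) 0"
  proof -
    have "int (p ^ Suc n - 1) = int p ^ Suc n - 1"
      using p by (subst of_nat_diff) auto
    then have N: "int r * (int p ^ Suc n - 1) = int (r * (p ^ Suc n - 1))"
      by (simp only: of_nat_mult)
    show ?thesis
    proof (rule Set.set_eqI)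
      fix t
      show "t \<in> {t \<in> ?T. \<forall>i\<in>{1..n}. r * (p ^ i - 1) < wt m (\<lambda>x. t x mod p ^ i)} \<longleftrightarrow>
          t \<in> heavy_exps p r m n (exps m) 0"
        unfolding heavy_exps_def mem_Collect_eq mult_zero_right add_0_right N of_nat_eq_iff
        using mod_div_exps(2)[of t m "p ^ n"] by blast
    qed
  qed
  finally show ?thesis .
qed

section \<open>Minimal numbers of generators of free modules\<close>

text \<open>If \<open>l < n\<close>, padding both factors with zeros to \<open>n \<times> n\<close> matrices makes the determinants vanish.\<close>

lemma invertible_factor_bound:
  fixes B C :: "nat \<Rightarrow> nat \<Rightarrow> 'a::comm_ring_1"
  assumes "\<And>i j. i < n \<Longrightarrow> j < n \<Longrightarrow> (\<Sum>k<l. B i k * C k j) = (if i = j then 1 else 0)"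
  shows "n \<le> l"
proof (rule ccontr)
  assume "\<not> n \<le> l"
  then have l: "l < n" by simp
  define B' where "B' = mat n n (\<lambda>(i, k). if k < l then B i k else 0)"
  define C' where "C' = mat n n (\<lambda>(k, j). if k < l then C k j else 0)"
  have B': "B' \<in> carrier_mat n n" and C': "C' \<in> carrier_mat n n" by (auto simp: B'_def C'_def)
  have "B' * C' = 1\<^sub>m n"
  proof (rule eq_matI)
    fix i j assume "i < dim_row (1\<^sub>m n :: 'a mat)" "j < dim_col (1\<^sub>m n :: 'a mat)"
    then have ij: "i < n" "j < n" by auto
    have "(B' * C') $$ (i, j) = (\<Sum>k<n. if k < l then B i k * C k j else 0)"
      using ij by (auto simp: B'_def C'_def scalar_prod_def atLeast0LessThan intro!: sum.cong)
    also have "\<dots> = (\<Sum>k<l. B i k * C k j)"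
      using l by (intro sum.mono_neutral_cong_right) auto
    finally show "(B' * C') $$ (i, j) = 1\<^sub>m n $$ (i, j)" using assms ij by simp
  qed (auto simp: B'_def C'_def)
  then have "det B' * det C' = 1" using det_mult[OF B' C'] by simp
  moreover have "(\<Prod>i = 0..<n. C' $$ (i, \<pi> i)) = 0" if "\<pi> permutes {0..<n}" for \<pi>
    using l that by (intro prod_zero bexI[of _ l]) (auto simp: C'_def permutes_in_image[OF that])
  then have "det C' = 0" by (simp add: det_def'[OF C'])
  ultimately show False by simp
qed

text \<open>The coordinates \<open>\<phi>\<close> identify \<open>M\<close> with the free module on
  \<open>T\<close>. The unit vectors generate it; conversely, writing them through a generating set
  \<open>X\<close> factors the identity matrix of size \<open>card T\<close> through
  \<open>card X\<close>, and \<open>invertible_factor_bound\<close> applies.\<close>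

lemma min_num_generators_free:
  fixes R :: "('b, 'c) ring_scheme" and M :: "('b, 'd, 'e) module_scheme"
    and \<phi> :: "'d \<Rightarrow> 't \<Rightarrow> 'a::comm_ring_1" and \<psi> :: "'b \<Rightarrow> 'a"
  assumes T: "finite T"
    and bij: "bij_betw \<phi> (carrier M) {v. \<forall>t. t \<notin> T \<longrightarrow> v t = 0}"
    and add: "\<And>x y. x \<in> carrier M \<Longrightarrow> y \<in> carrier M \<Longrightarrow>
       x \<oplus>\<^bsub>M\<^esub> y \<in> carrier M \<and> \<phi> (x \<oplus>\<^bsub>M\<^esub> y) = (\<lambda>t. \<phi> x t + \<phi> y t)"
    and zero: "\<zero>\<^bsub>M\<^esub> \<in> carrier M" "\<phi> \<zero>\<^bsub>M\<^esub> = (\<lambda>_. 0)"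
    and scal: "\<psi> ` carrier R = UNIV"
    and smult: "\<And>a x. a \<in> carrier R \<Longrightarrow> x \<in> carrier M \<Longrightarrow>
       a \<odot>\<^bsub>M\<^esub> x \<in> carrier M \<and> \<phi> (a \<odot>\<^bsub>M\<^esub> x) = (\<lambda>t. \<psi> a * \<phi> x t)"
  shows "min_num_generators R M = card T"
proof -
  let ?V = "{v :: 't \<Rightarrow> 'a. \<forall>t. t \<notin> T \<longrightarrow> v t = 0}"
  define \<theta> where "\<theta> = the_inv_into (carrier M) \<phi>"
  have inj: "inj_on \<phi> (carrier M)" and img: "\<phi> ` carrier M = ?V"
    using bij by (auto simp: bij_betw_def)
  have \<theta>: "\<theta> v \<in> carrier M" "\<phi> (\<theta> v) = v" if "v \<in> ?V" for v
    using that the_inv_into_into[OF inj _ subset_refl] f_the_inv_into_f[OF inj] img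
    unfolding \<theta>_def by auto
  have \<phi>V: "\<phi> x \<in> ?V" if "x \<in> carrier M" for x using that img by blast
  have eqI: "x = y" if "x \<in> carrier M" "y \<in> carrier M" "\<phi> x = \<phi> y" for x y
    using inj that by (auto dest: inj_onD)
  \<comment> \<open>The group laws hold for coordinates and come back along the injective
    \<open>\<phi>\<close>; negatives are supplied by its inverse \<open>\<theta>\<close>.\<close>
  interpret comm_group "add_monoid M"
  proof (rule comm_groupI, goal_cases)
    case (6 x)
    have "\<theta> (\<lambda>t. - \<phi> x t) \<in> carrier M" "\<phi> (\<theta> (\<lambda>t. - \<phi> x t)) = (\<lambda>t. - \<phi> x t)"
      using \<theta>[of "\<lambda>t. - \<phi> x t"] \<phi>V[of x] 6 by auto
    then show ?case using 6 zero add eqI[of "\<theta> (\<lambda>t. - \<phi> x t) \<oplus>\<^bsub>M\<^esub> x" "\<zero>\<^bsub>M\<^esub>"] by auto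
  qed (auto simp: add zero ac_simps intro!: eqI)
  have subI: "submodule H R M"
    if H: "H \<subseteq> carrier M" "\<zero>\<^bsub>M\<^esub> \<in> H" "\<And>x y. x \<in> H \<Longrightarrow> y \<in> H \<Longrightarrow> x \<oplus>\<^bsub>M\<^esub> y \<in> H"
      "\<And>a x. a \<in> carrier R \<Longrightarrow> x \<in> H \<Longrightarrow> a \<odot>\<^bsub>M\<^esub> x \<in> H" for H
  proof (intro submodule.intro submodule_axioms.intro subgroupI)
    fix x assume x: "x \<in> H"
    \<comment> \<open>A scalar acting as -1 reduces closure under inverses to closure under
      scalars.\<close>
    obtain a where a: "a \<in> carrier R" "\<psi> a = - 1" using scal by (metis UNIV_I imageE)
    have xM: "x \<in> carrier M" using x H by blast
    have "a \<odot>\<^bsub>M\<^esub> x \<oplus>\<^bsub>M\<^esub> x = \<zero>\<^bsub>M\<^esub>"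
      using xM a by (intro eqI) (auto simp: smult add zero)
    then have "inv\<^bsub>add_monoid M\<^esub> x = a \<odot>\<^bsub>M\<^esub> x"
      using xM a smult by (intro inv_equality) auto
    then show "inv\<^bsub>add_monoid M\<^esub> x \<in> H" using H(4)[OF a(1) x] by simp
  qed (use H in auto)
  have subM: "submodule (carrier M) R M" by (rule subI) (auto simp: zero add smult)
  show ?thesis unfolding min_num_generators_def
  proof (rule Least_equality)
    define b where "b t = \<theta> (\<lambda>u. if u = t then 1 else 0)" for t
    have b: "b t \<in> carrier M" "\<phi> (b t) = (\<lambda>u. if u = t then 1 else 0)" if "t \<in> T" for t
      using \<theta>[of "\<lambda>u. if u = t then 1 else 0"] that by (auto simp: b_def)
    \<comment> \<open>Since 1 and 0 differ in \<open>'a\<close>, there are exactly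
      \<open>card T\<close> unit vectors.\<close>
    have "inj_on b T"
    proof (rule inj_onI)
      fix t u assume *: "t \<in> T" "u \<in> T" "b t = b u"
      then have "(\<lambda>v. if v = t then 1 else (0::'a)) = (\<lambda>u'. if u' = u then 1 else 0)" using b by metis
      from fun_cong[OF this, of t] show "t = u" by (auto split: if_splits)
    qed
    moreover have "(\<lambda>H. submodule H R M) hull (b ` T) = carrier M"
    proof (rule hull_unique)
      fix H assume HT: "b ` T \<subseteq> H" and Hs: "submodule H R M"
      interpret H: submodule H R M by (rule Hs)
      have Hadd: "x \<oplus>\<^bsub>M\<^esub> y \<in> H" if "x \<in> H" "y \<in> H" for x y using H.m_closed[OF that] by simp
      have HM: "H \<subseteq> carrier M" using H.subset by simp
      \<comment> \<open>Adding one unit vector at a time realises any coordinates supported on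
        \<open>F\<close> inside \<open>H\<close>.\<close>
      have "\<exists>x\<in>H. \<phi> x = (\<lambda>t. if t \<in> F then v t else 0)" if "finite F" "F \<subseteq> T" for F v
        using that
      proof induction
        case empty
        then show ?case using H.one_closed zero by auto
      next
        case (insert s F)
        then obtain x where x: "x \<in> H" "\<phi> x = (\<lambda>t. if t \<in> F then v t else 0)" by auto
        obtain a where a: "a \<in> carrier R" "\<psi> a = v s" using scal by (metis UNIV_I imageE)
        have bs: "b s \<in> H" "s \<in> T" using HT insert by auto
        have "a \<odot>\<^bsub>M\<^esub> b s \<oplus>\<^bsub>M\<^esub> x \<in> H" using Hadd H.smult_closed[OF a(1) bs(1)] x by blast
        moreover have "\<phi> (a \<odot>\<^bsub>M\<^esub> b s \<oplus>\<^bsub>M\<^esub> x) = (\<lambda>t. if t \<in> insert s F then v t else 0)"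
          using add[of "a \<odot>\<^bsub>M\<^esub> b s" x] smult[OF a(1), of "b s"] b[OF bs(2)] x HM a insert
          by (auto simp: fun_eq_iff)
        ultimately show ?case by blast
      qed
      note span = this[OF T subset_refl]
      show "carrier M \<subseteq> H"
      proof
        fix y assume y: "y \<in> carrier M"
        obtain x where x: "x \<in> H" "\<phi> x = (\<lambda>t. if t \<in> T then \<phi> y t else 0)" using span by blast
        have "\<phi> x = \<phi> y" using x \<phi>V[OF y] by auto
        then show "y \<in> H" using eqI[of x y] x y HM by blast
      qed
    qed (use b subM in auto)
    ultimately show "\<exists>X\<subseteq>carrier M. finite X \<and> card X = card T \<and> (\<lambda>H. submodule H R M) hull X = carrier M"
      using b T by (intro exI[of _ "b ` T"]) (auto simp: card_image)
  next
    fix n assume "\<exists>X\<subseteq>carrier M. finite X \<and> card X = n \<and> (\<lambda>H. submodule H R M) hull X = carrier M"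
    then obtain X where X: "X \<subseteq> carrier M" "finite X" "card X = n"
      "(\<lambda>H. submodule H R M) hull X = carrier M" by blast
    \<comment> \<open>The span of \<open>X\<close>, described by coordinates; a submodule containing
      \<open>X\<close>, hence all of \<open>M\<close>.\<close>
    define H where "H = {x \<in> carrier M. \<exists>c. \<phi> x = (\<lambda>t. \<Sum>y\<in>X. c y * \<phi> y t)}"
    have "submodule H R M"
    proof (rule subI)
      show "\<zero>\<^bsub>M\<^esub> \<in> H" using zero by (auto simp: H_def intro!: exI[of _ "\<lambda>_. 0"])
    next
      fix x y assume "x \<in> H" "y \<in> H"
      then obtain c c' where xy: "\<phi> x = (\<lambda>t. \<Sum>y\<in>X. c y * \<phi> y t)" "\<phi> y = (\<lambda>t. \<Sum>y\<in>X. c' y * \<phi> y t)"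
        and M: "x \<in> carrier M" "y \<in> carrier M" by (auto simp: H_def)
      have "\<phi> (x \<oplus>\<^bsub>M\<^esub> y) = (\<lambda>t. \<Sum>z\<in>X. (c z + c' z) * \<phi> z t)"
        unfolding add[OF M, THEN conjunct2] xy by (simp add: sum.distrib distrib_right)
      then show "x \<oplus>\<^bsub>M\<^esub> y \<in> H" unfolding H_def mem_Collect_eq using add[OF M]
        by (intro conjI exI[of _ "\<lambda>z. c z + c' z"]) blast+
    next
      fix a x assume "a \<in> carrier R" "x \<in> H"
      then obtain c where x: "\<phi> x = (\<lambda>t. \<Sum>y\<in>X. c y * \<phi> y t)" and M: "a \<in> carrier R" "x \<in> carrier M"
        by (auto simp: H_def)
      have "\<phi> (a \<odot>\<^bsub>M\<^esub> x) = (\<lambda>t. \<Sum>z\<in>X. (\<psi> a * c z) * \<phi> z t)"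
        unfolding smult[OF M, THEN conjunct2] x by (simp add: sum_distrib_left mult.assoc)
      then show "a \<odot>\<^bsub>M\<^esub> x \<in> H" unfolding H_def mem_Collect_eq using smult[OF M]
        by (intro conjI exI[of _ "\<lambda>z. \<psi> a * c z"]) blast+
    qed (auto simp: H_def)
    moreover have "X \<subseteq> H"
    proof
      fix x assume x: "x \<in> X"
      have "\<phi> x = (\<lambda>t. \<Sum>y\<in>X. (if y = x then 1 else 0) * \<phi> y t)"
        using x X(2) by (auto simp: fun_eq_iff sum.remove[OF X(2) x])
      then show "x \<in> H" using x X(1) unfolding H_def mem_Collect_eq
        by (intro conjI exI[of _ "\<lambda>y. if y = x then 1 else 0"]) auto
    qed
    ultimately have "carrier M \<subseteq> H" using X(4) hull_minimal by metis
    then have "\<exists>c. \<forall>u\<in>T. (\<Sum>y\<in>X. c y * \<phi> y u) = (if u = t then 1 else 0)" if t: "t \<in> T" for t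
    proof -
      let ?e = "\<lambda>u. if u = t then 1 else (0::'a)"
      have e: "\<theta> ?e \<in> carrier M" "\<phi> (\<theta> ?e) = ?e" using \<theta>[of ?e] t by auto
      then obtain c where "\<phi> (\<theta> ?e) = (\<lambda>u. \<Sum>y\<in>X. c y * \<phi> y u)"
        using \<open>carrier M \<subseteq> H\<close> unfolding H_def by blast
      then show ?thesis unfolding e(2) by (intro exI[of _ c]) (metis (no_types))
    qed
    \<comment> \<open>Row \<open>c t\<close> writes the unit vector at \<open>t\<close> through
      \<open>X\<close>: this is the left factor of the identity matrix.\<close>
    then obtain c where c: "\<And>t u. t \<in> T \<Longrightarrow> u \<in> T \<Longrightarrow>
        (\<Sum>y\<in>X. c t y * \<phi> y u) = (if u = t then 1 else 0)" by (metis (no_types))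
    obtain f where f: "bij_betw f {..<card T} T" using ex_bij_betw_nat_finite[OF T] by (auto simp: atLeast0LessThan)
    obtain g where g: "bij_betw g {..<n} X" using ex_bij_betw_nat_finite[OF X(2)] X(3) by (auto simp: atLeast0LessThan)
    show "card T \<le> n"
    proof (rule invertible_factor_bound[where B = "\<lambda>i k. c (f i) (g k)" and C = "\<lambda>k j. \<phi> (g k) (f j)"])
      fix i j assume ij: "i < card T" "j < card T"
      have "(\<Sum>k<n. c (f i) (g k) * \<phi> (g k) (f j)) = (\<Sum>y\<in>X. c (f i) y * \<phi> y (f j))"
        by (rule sum.reindex_bij_betw[OF g])
      also have "\<dots> = (if f j = f i then 1 else 0)"
        using ij bij_betwE[OF f] by (intro c) auto
      also have "f j = f i \<longleftrightarrow> i = j" using ij f by (auto simp: bij_betw_def inj_on_def)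
      finally show "(\<Sum>k<n. c (f i) (g k) * \<phi> (g k) (f j)) = (if i = j then 1 else 0)" .
    qed
  qed
qed

section \<open>The twisted ring\<close>

lemma CHAR_poly_mapping:
  "CHAR((nat \<Rightarrow>\<^sub>0 nat) \<Rightarrow>\<^sub>0 'a::comm_ring_1) = CHAR('a)"
proof (rule CHAR_eqI)
  have *: "(of_nat n :: (nat \<Rightarrow>\<^sub>0 nat) \<Rightarrow>\<^sub>0 'a) = 0 \<longleftrightarrow> (of_nat n :: 'a) = 0" for n
  proof
    assume "(of_nat n :: (nat \<Rightarrow>\<^sub>0 nat) \<Rightarrow>\<^sub>0 'a) = 0"
    then have "Poly_Mapping.lookup (of_nat n :: (nat \<Rightarrow>\<^sub>0 nat) \<Rightarrow>\<^sub>0 'a) 0 = 0" by simp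
    then show "(of_nat n :: 'a) = 0" by (simp add: lookup_of_nat)
  next
    assume "(of_nat n :: 'a) = 0"
    then show "(of_nat n :: (nat \<Rightarrow>\<^sub>0 nat) \<Rightarrow>\<^sub>0 'a) = 0" by (intro poly_mapping_eqI) (simp add: lookup_of_nat)
  qed
  show "(of_nat CHAR('a) :: (nat \<Rightarrow>\<^sub>0 nat) \<Rightarrow>\<^sub>0 'a) = 0" by (simp add: *)
  show "CHAR('a) dvd n" if "(of_nat n :: (nat \<Rightarrow>\<^sub>0 nat) \<Rightarrow>\<^sub>0 'a) = 0" for n
    using that by (simp only: * of_nat_eq_0_iff_char_dvd)
qed

lemma poly_mapping_eq_sum_singles:
  "(\<Sum>t\<in>Poly_Mapping.keys g. Poly_Mapping.single t (Poly_Mapping.lookup g t)) = g"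
  by (rule poly_mapping_eqI) (auto simp: lookup_sum lookup_single when_def in_keys_iff)

lemma single_power:
  "Poly_Mapping.single t c ^ q = Poly_Mapping.single (exp_scale q t) (c ^ q)"
proof (induction q)
  case 0
  have "exp_scale 0 t = 0" by (rule poly_mapping_eqI) simp
  then show ?case by simp
next
  case (Suc q)
  have "exp_scale (Suc q) t = t + exp_scale q t" by (rule poly_mapping_eqI) (simp add: lookup_add)
  then show ?case using Suc by (simp add: mult_single)
qed

text \<open>In characteristic \<open>p\<close> this power is additive, so it acts on each term
  separately. Equality can fail: powers of nilpotent coefficients may vanish.\<close>

lemma keys_frobenius:
  fixes g :: "(nat \<Rightarrow>\<^sub>0 nat) \<Rightarrow>\<^sub>0 'a::comm_ring_1"
  assumes "prime p" "CHAR('a) = p"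
  shows "Poly_Mapping.keys (g ^ (p ^ i)) \<subseteq> exp_scale (p ^ i) ` Poly_Mapping.keys g"
proof -
  have "g ^ (p ^ i) = (\<Sum>t\<in>Poly_Mapping.keys g. Poly_Mapping.single t (Poly_Mapping.lookup g t)) ^ (p ^ i)"
    by (simp only: poly_mapping_eq_sum_singles)
  also have "\<dots> = (\<Sum>t\<in>Poly_Mapping.keys g. Poly_Mapping.single t (Poly_Mapping.lookup g t) ^ (p ^ i))"
    by (rule freshmans_dream_sum') (simp_all add: CHAR_poly_mapping assms)
  finally have "g ^ (p ^ i) =
      (\<Sum>t\<in>Poly_Mapping.keys g. Poly_Mapping.single (exp_scale (p ^ i) t) (Poly_Mapping.lookup g t ^ (p ^ i)))"
    by (simp only: single_power)
  then have "Poly_Mapping.lookup (g ^ (p ^ i)) u = 0" if "u \<notin> exp_scale (p ^ i) ` Poly_Mapping.keys g" for u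
    using that by (auto simp: lookup_sum lookup_single when_def intro!: sum.neutral)
  then show ?thesis by (auto simp: in_keys_iff)
qed

lemma keys_sum_subset:
  assumes "\<And>i. i \<in> I \<Longrightarrow> Poly_Mapping.keys (f i) \<subseteq> S"
  shows "Poly_Mapping.keys (sum f I) \<subseteq> S"
proof -
  have "Poly_Mapping.lookup (sum f I) t = 0" if "t \<notin> S" for t
  proof -
    have "Poly_Mapping.lookup (f i) t = 0" if "i \<in> I" for i
      using assms[OF that] \<open>t \<notin> S\<close> by (metis in_keys_iff subsetD)
    then show ?thesis by (simp add: lookup_sum)
  qed
  then show ?thesis by (auto simp: in_keys_iff)
qed

lemma keys_uminus [simp]:
  "Poly_Mapping.keys (- f) = Poly_Mapping.keys (f :: _ \<Rightarrow>\<^sub>0 'a::ab_group_add)"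
  by (auto simp: in_keys_iff)

lemma lookup_scalar_mult:
  "Poly_Mapping.lookup (Poly_Mapping.single 0 c * f) (t :: nat \<Rightarrow>\<^sub>0 nat) = (c :: 'a::comm_ring_1) * Poly_Mapping.lookup f t"
  by (simp add: map.rep_eq when_def flip: mult_map_scale_conv_mult)

definition hom_elt :: "nat \<Rightarrow> 'b::zero \<Rightarrow> nat \<Rightarrow> 'b" where
  "hom_elt e x = (\<lambda>i. if i = e then x else 0)"

section \<open>The graded structure of the twisted ring\<close>

locale twisted_veronese =
  fixes p r m :: nat and A :: "(nat \<Rightarrow> ((nat \<Rightarrow>\<^sub>0 nat) \<Rightarrow>\<^sub>0 'a::comm_ring_1)) ring"
    and D :: "nat \<Rightarrow> (nat \<Rightarrow> ((nat \<Rightarrow>\<^sub>0 nat) \<Rightarrow>\<^sub>0 'a)) set"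
  assumes prime: "prime p" and char: "CHAR('a) = p"
    and A_def: "A = twisted_ring p (veronese r (poly_piece m))"
    and D_def: "D = twisted_piece p (veronese r (poly_piece m))"
begin

abbreviation mons :: "nat \<Rightarrow> (nat \<Rightarrow>\<^sub>0 nat) set" where
  "mons e \<equiv> monomials m (r * (p ^ e - 1))"

lemma p_pos: "p > 0" using prime by (simp add: prime_gt_0_nat)

lemma carrier_iff:
  "f \<in> carrier A \<longleftrightarrow> finite {e. f e \<noteq> 0} \<and> (\<forall>e. Poly_Mapping.keys (f e) \<subseteq> mons e)"
  by (simp add: A_def twisted_ring_def veronese_def poly_piece_eq)

lemma A_simps [simp]:
  "f \<oplus>\<^bsub>A\<^esub> g = (\<lambda>e. f e + g e)" "\<zero>\<^bsub>A\<^esub> = (\<lambda>e. 0)" "\<one>\<^bsub>A\<^esub> = hom_elt 0 1"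
  "f \<otimes>\<^bsub>A\<^esub> g = (\<lambda>n. \<Sum>e\<le>n. f e * g (n - e) ^ (p ^ e))"
  by (simp_all add: A_def twisted_ring_def hom_elt_def fun_eq_iff)

lemma D_iff: "f \<in> D e \<longleftrightarrow> Poly_Mapping.keys (f e) \<subseteq> mons e \<and> (\<forall>i. i \<noteq> e \<longrightarrow> f i = 0)"
proof -
  have "f \<in> carrier A" if "Poly_Mapping.keys (f e) \<subseteq> mons e" "\<forall>i. i \<noteq> e \<longrightarrow> f i = 0"
  proof -
    have "{i. f i \<noteq> 0} \<subseteq> {e}" using that by auto
    then have "finite {i. f i \<noteq> 0}" by (rule finite_subset) simp
    moreover have "Poly_Mapping.keys (f i) \<subseteq> mons i" for i using that by (cases "i = e") auto
    ultimately show ?thesis by (simp add: carrier_iff)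
  qed
  moreover have "f \<in> D e \<longleftrightarrow> f \<in> carrier A \<and> (\<forall>i. i \<noteq> e \<longrightarrow> f i = 0)"
    by (simp add: D_def A_def twisted_piece_def)
  ultimately show ?thesis by (auto simp: carrier_iff)
qed

lemma D_subset: "D e \<subseteq> carrier A"
  by (auto simp: D_def A_def twisted_piece_def)

lemma D_add: "f \<in> D e \<Longrightarrow> g \<in> D e \<Longrightarrow> (\<lambda>i. f i + g i) \<in> D e"
  using keys_add[of "f e" "g e"] unfolding D_iff by auto

lemma D_diff: "f \<in> D e \<Longrightarrow> g \<in> D e \<Longrightarrow> (\<lambda>i. f i - g i) \<in> D e"
  using keys_add[of "f e" "- g e"] unfolding D_iff by auto

lemma hom_elt_in_D: "Poly_Mapping.keys x \<subseteq> mons e \<Longrightarrow> hom_elt e x \<in> D e"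
  by (simp add: D_iff hom_elt_def)

lemma mult_hom_elt: "hom_elt i x \<otimes>\<^bsub>A\<^esub> hom_elt j y = hom_elt (i + j) (x * y ^ (p ^ i))"
proof
  fix n
  have "(hom_elt i x \<otimes>\<^bsub>A\<^esub> hom_elt j y) n = (\<Sum>k\<le>n. if k = i then x * hom_elt j y (n - i) ^ (p ^ i) else 0)"
    unfolding A_simps by (rule sum.cong) (auto simp: hom_elt_def)
  also have "\<dots> = hom_elt (i + j) (x * y ^ (p ^ i)) n"
    \<comment> \<open>As \<open>p ^ i\<close> is positive, zero components stay zero under the
      Frobenius power.\<close>
    using p_pos by (auto simp: hom_elt_def power_0_left)
  finally show "(hom_elt i x \<otimes>\<^bsub>A\<^esub> hom_elt j y) n = hom_elt (i + j) (x * y ^ (p ^ i)) n" .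
qed

lemma add_closed: "f \<in> carrier A \<Longrightarrow> g \<in> carrier A \<Longrightarrow> (\<lambda>e. f e + g e) \<in> carrier A"
proof -
  assume *: "f \<in> carrier A" "g \<in> carrier A"
  have "{e. f e + g e \<noteq> 0} \<subseteq> {e. f e \<noteq> 0} \<union> {e. g e \<noteq> 0}" by auto
  then have "finite {e. f e + g e \<noteq> 0}" using * finite_subset unfolding carrier_iff by blast
  moreover have "Poly_Mapping.keys (f e + g e) \<subseteq> mons e" for e
    using * keys_add[of "f e" "g e"] unfolding carrier_iff by blast
  ultimately show ?thesis by (simp add: carrier_iff)
qed

lemma uminus_closed: "f \<in> carrier A \<Longrightarrow> (\<lambda>e. - f e) \<in> carrier A"
  by (simp add: carrier_iff)

lemma abelian_group: "abelian_group A"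
proof (rule abelian_groupI)
  fix f assume "f \<in> carrier A"
  then show "\<exists>g\<in>carrier A. g \<oplus>\<^bsub>A\<^esub> f = \<zero>\<^bsub>A\<^esub>"
    by (intro bexI[of _ "\<lambda>e. - f e"]) (auto simp: uminus_closed)
next
  show "\<zero>\<^bsub>A\<^esub> \<in> carrier A" by (simp add: carrier_iff)
qed (auto simp: add_closed add_ac)

lemma a_inv_eq: "f \<in> carrier A \<Longrightarrow> \<ominus>\<^bsub>A\<^esub> f = (\<lambda>e. - f e)"
  by (rule abelian_group.minus_equality[OF abelian_group]) (auto simp: uminus_closed)

text \<open>The link between the ring and the exponents: each monomial of a twisted product is a
  twisted product of monomials of the allowed degrees.\<close>

lemma keys_twisted_mult:
  assumes "Poly_Mapping.keys (f :: _ \<Rightarrow>\<^sub>0 'a) \<subseteq> mons i" "Poly_Mapping.keys g \<subseteq> mons j"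
  shows "Poly_Mapping.keys (f * g ^ (p ^ i)) \<subseteq> {a + exp_scale (p ^ i) b | a b. a \<in> mons i \<and> b \<in> mons j}"
  using keys_mult[of f "g ^ (p ^ i)"] keys_frobenius[OF prime char, of g i] assms by blast

lemma mult_closed:
  assumes f: "f \<in> carrier A" and g: "g \<in> carrier A"
  shows "f \<otimes>\<^bsub>A\<^esub> g \<in> carrier A"
proof -
  have fin: "finite {e. f e \<noteq> 0}" "finite {e. g e \<noteq> 0}"
    and keys: "\<And>e. Poly_Mapping.keys (f e) \<subseteq> mons e" "\<And>e. Poly_Mapping.keys (g e) \<subseteq> mons e"
    using f g unfolding carrier_iff by blast+
  have "{n. (f \<otimes>\<^bsub>A\<^esub> g) n \<noteq> 0} \<subseteq> (\<lambda>(i, j). i + j) ` ({e. f e \<noteq> 0} \<times> {e. g e \<noteq> 0})"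
  proof
    fix n assume "n \<in> {n. (f \<otimes>\<^bsub>A\<^esub> g) n \<noteq> 0}"
    then obtain e where e: "e \<le> n" "f e * g (n - e) ^ (p ^ e) \<noteq> 0"
      by (auto elim: sum.not_neutral_contains_not_neutral)
    then have "f e \<noteq> 0" "g (n - e) \<noteq> 0" using p_pos by (auto simp: power_0_left)
    then show "n \<in> (\<lambda>(i, j). i + j) ` ({e. f e \<noteq> 0} \<times> {e. g e \<noteq> 0})"
      using e(1) by (intro image_eqI[of _ _ "(e, n - e)"]) auto
  qed
  then have "finite {n. (f \<otimes>\<^bsub>A\<^esub> g) n \<noteq> 0}" by (rule finite_subset) (use fin in auto)
  moreover have "Poly_Mapping.keys ((f \<otimes>\<^bsub>A\<^esub> g) n) \<subseteq> mons n" for n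
    unfolding A_simps
  proof (rule keys_sum_subset)
    fix e assume "e \<in> {..n}"
    then have "n = e + (n - e)" by simp
    then show "Poly_Mapping.keys (f e * g (n - e) ^ (p ^ e)) \<subseteq> mons n"
      using keys_twisted_mult[OF keys(1)[of e] keys(2)[of "n - e"]]
        monomials_add_exp_scale[OF _ _ p_pos, of _ m r e _ "n - e"] by auto
  qed
  ultimately show ?thesis by (simp add: carrier_iff)
qed

section \<open>Degree zero and the subrings generated in lower degree\<close>

lemma D_0: "f \<in> D 0 \<longleftrightarrow> (\<exists>c. f = hom_elt 0 (Poly_Mapping.single 0 c))"
proof
  assume f: "f \<in> D 0"
  have "Poly_Mapping.keys (f 0) \<subseteq> {0}" using f by (simp add: D_iff monomials_0)
  then have "f 0 = Poly_Mapping.single 0 (Poly_Mapping.lookup (f 0) 0)"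
    by (intro poly_mapping_eqI) (auto simp: lookup_single when_def in_keys_iff)
  then have "f = hom_elt 0 (Poly_Mapping.single 0 (Poly_Mapping.lookup (f 0) 0))"
    using f by (auto simp: D_iff hom_elt_def)
  then show "\<exists>c. f = hom_elt 0 (Poly_Mapping.single 0 c)" by blast
qed (auto simp: D_iff hom_elt_def monomials_0 split: if_splits)

text \<open>Membership in \<open>carrier A\<close> belongs to the invariant because the product case
  needs the monomials of all components, not only of the one in degree \<open>e\<close>.\<close>

lemma generate_decomposables:
  assumes e: "e > 0" and f: "f \<in> generate_ring A (\<Union>i\<in>{..<e}. D i)"
  shows "f \<in> carrier A \<and> Poly_Mapping.keys (f e) \<subseteq> decomposables p r m e"
  using f
proof induction
  case one
  have "hom_elt 0 1 \<in> D 0" by (subst D_0) (metis single_one)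
  then show ?case using e D_subset[of 0] by (auto simp: hom_elt_def)
next
  case (incl h)
  then obtain i where "i < e" "h \<in> D i" by blast
  then show ?case using D_subset[of i] by (auto simp: D_iff)
next
  case (a_inv h)
  then show ?case by (simp add: a_inv_eq uminus_closed)
next
  case (eng_add h1 h2)
  then show ?case using keys_add[of "h1 e" "h2 e"] by (auto simp: add_closed)
next
  case (eng_mult f g)
  have keys: "Poly_Mapping.keys (f i) \<subseteq> mons i" "Poly_Mapping.keys (g i) \<subseteq> mons i" for i
    using eng_mult.IH unfolding carrier_iff by blast+
  have "Poly_Mapping.keys ((f \<otimes>\<^bsub>A\<^esub> g) e) \<subseteq> decomposables p r m e"
    unfolding A_simps
  proof (rule keys_sum_subset)
    fix i assume i: "i \<in> {..e}"
    \<comment> \<open>For \<open>i = 0\<close> and \<open>i = e\<close> one factor is a scalar, so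
      the induction hypothesis for the other one suffices; the remaining terms are decomposable by
      construction.\<close>
    consider "i = 0" | "i = e" "i \<noteq> 0" | "i \<in> {1..<e}" using i by fastforce
    then show "Poly_Mapping.keys (f i * g (e - i) ^ (p ^ i)) \<subseteq> decomposables p r m e"
    proof cases
      case 1
      have "Poly_Mapping.keys (f 0) \<subseteq> {0}" using keys(1)[of 0] by (simp add: monomials_0)
      then have "Poly_Mapping.keys (f 0 * g e) \<subseteq> Poly_Mapping.keys (g e)"
        using keys_mult[of "f 0" "g e"] by fastforce
      then show ?thesis using 1 eng_mult.IH by auto
    next
      case 2
      have "Poly_Mapping.keys (g 0) \<subseteq> {0}" using keys(2)[of 0] by (simp add: monomials_0)
      moreover have "exp_scale (p ^ e) 0 = 0" by (rule poly_mapping_eqI) simp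
      ultimately have "Poly_Mapping.keys (g 0 ^ (p ^ e)) \<subseteq> {0}"
        using keys_frobenius[OF prime char, of "g 0" e] by auto
      then have "Poly_Mapping.keys (f e * g 0 ^ (p ^ e)) \<subseteq> Poly_Mapping.keys (f e)"
        using keys_mult[of "f e" "g 0 ^ (p ^ e)"] by fastforce
      then show ?thesis using 2 eng_mult.IH by auto
    next
      case 3
      then show ?thesis using keys_twisted_mult[OF keys(1)[of i] keys(2)[of "e - i"]]
        unfolding decomposables_def by blast
    qed
  qed
  then show ?case using eng_mult.IH mult_closed by blast
qed

text \<open>Zero arises as 1 + (-1), whatever the generators.\<close>

lemma generate_ring_zero: "(\<lambda>_. 0) \<in> generate_ring A S"
proof -
  have "\<one>\<^bsub>A\<^esub> \<in> carrier A" using D_subset[of 0] D_0 by (metis A_simps(3) single_one subsetD)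
  then have "\<one>\<^bsub>A\<^esub> \<oplus>\<^bsub>A\<^esub> (\<ominus>\<^bsub>A\<^esub> \<one>\<^bsub>A\<^esub>) = (\<lambda>_. 0)" by (subst a_inv_eq) auto
  moreover have "\<one>\<^bsub>A\<^esub> \<oplus>\<^bsub>A\<^esub> (\<ominus>\<^bsub>A\<^esub> \<one>\<^bsub>A\<^esub>) \<in> generate_ring A S"
    by (intro generate_ring.intros)
  ultimately show ?thesis by metis
qed

text \<open>Each term with a decomposable exponent is a product of two homogeneous elements of
  degree below \<open>e\<close>.\<close>

lemma decomposables_generate:
  assumes "Poly_Mapping.keys x \<subseteq> decomposables p r m e"
  shows "hom_elt e x \<in> generate_ring A (\<Union>i\<in>{..<e}. D i)"
proof -
  let ?G = "generate_ring A (\<Union>i\<in>{..<e}. D i)"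
  have single: "hom_elt e (Poly_Mapping.single t c) \<in> ?G" if t: "t \<in> decomposables p r m e" for t c
  proof -
    obtain i a b where i: "i \<in> {1..<e}" and ab: "a \<in> mons i" "b \<in> mons (e - i)" "t = a + exp_scale (p ^ i) b"
      using t unfolding decomposables_def by blast
    have D: "hom_elt j (Poly_Mapping.single u d) \<in> ?G" if "u \<in> mons j" "j < e" for j u d
    proof (rule generate_ring.incl, rule UN_I)
      show "hom_elt j (Poly_Mapping.single u d) \<in> D j" using that(1) by (intro hom_elt_in_D) simp
    qed (use that(2) in simp)
    \<comment> \<open>The coefficient goes to the left factor; on the right it would be raised to
      the power \<open>p ^ i\<close>.\<close>
    have "hom_elt i (Poly_Mapping.single a c) \<otimes>\<^bsub>A\<^esub> hom_elt (e - i) (Poly_Mapping.single b 1) \<in> ?G"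
      using i ab by (intro generate_ring.eng_mult D) auto
    then show ?thesis using i ab unfolding mult_hom_elt by (simp add: single_power mult_single)
  qed
  have "hom_elt e (\<Sum>t\<in>F. Poly_Mapping.single t (Poly_Mapping.lookup x t)) \<in> ?G"
    if "finite F" "F \<subseteq> decomposables p r m e" for F
    using that
  proof induction
    case empty
    then show ?case using generate_ring_zero by (simp add: hom_elt_def)
  next
    case (insert t F)
    then have "hom_elt e (Poly_Mapping.single t (Poly_Mapping.lookup x t)) \<oplus>\<^bsub>A\<^esub>
        hom_elt e (\<Sum>t\<in>F. Poly_Mapping.single t (Poly_Mapping.lookup x t)) \<in> ?G"
      by (intro generate_ring.eng_add single) auto
    also have "hom_elt e (Poly_Mapping.single t (Poly_Mapping.lookup x t)) \<oplus>\<^bsub>A\<^esub>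
        hom_elt e (\<Sum>t\<in>F. Poly_Mapping.single t (Poly_Mapping.lookup x t)) =
        hom_elt e (\<Sum>t\<in>insert t F. Poly_Mapping.single t (Poly_Mapping.lookup x t))"
      using insert by (auto simp: hom_elt_def)
    finally show ?case .
  qed
  from this[OF finite_keys assms] show ?thesis by (simp only: poly_mapping_eq_sum_singles)
qed

lemma G_below_D:
  assumes e: "e > 0"
  shows "G_below A D e \<inter> D e = {f \<in> D e. Poly_Mapping.keys (f e) \<subseteq> decomposables p r m e}"
proof -
  have "f = hom_elt e (f e)" if "f \<in> D e" for f using that by (auto simp: D_iff hom_elt_def)
  then have "f \<in> generate_ring A (\<Union>i\<in>{..<e}. D i) \<longleftrightarrow> Poly_Mapping.keys (f e) \<subseteq> decomposables p r m e"
    if "f \<in> D e" for f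
    using that generate_decomposables[OF e, of f] decomposables_generate[of "f e" e] by metis
  then show ?thesis using e unfolding G_below_def by auto
qed

text \<open>Both the piece \<open>D e\<close> and its submodule are spanned by monomials, so the
  quotient is free on the monomials in the difference.\<close>

lemma complexity_eq_card:
  assumes e: "e > 0"
  shows "complexity A D e = card (mons e - decomposables p r m e)"
proof -
  define T where "T = mons e - decomposables p r m e"
  define N where "N = {f \<in> D e. Poly_Mapping.keys (f e) \<subseteq> decomposables p r m e}"
  define Q where "Q = quotient_module A (D e) N"
  \<comment> \<open>An explicit form of the coset of \<open>x\<close>: \<open>N\<close> consists of
    the elements whose coefficients on \<open>T\<close> vanish, so cosets are compared by their
    coefficients on \<open>T\<close>.\<close>
  define K where "K x = {y \<in> D e. \<forall>t\<in>T. Poly_Mapping.lookup (y e) t = Poly_Mapping.lookup (x e) t}" for x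
  \<comment> \<open>Any representative may be chosen, since all elements of a coset agree on
    \<open>T\<close>.\<close>
  define \<phi> where "\<phi> X = (\<lambda>t. if t \<in> T then Poly_Mapping.lookup ((SOME x. x \<in> X) e) t else 0)" for X :: "(nat \<Rightarrow> (nat \<Rightarrow>\<^sub>0 nat) \<Rightarrow>\<^sub>0 'a) set"
  define \<psi> where "\<psi> f = Poly_Mapping.lookup (f 0) 0" for f :: "nat \<Rightarrow> (nat \<Rightarrow>\<^sub>0 nat) \<Rightarrow>\<^sub>0 'a"
  have N_iff: "h \<in> N \<longleftrightarrow> h \<in> D e \<and> (\<forall>t\<in>T. Poly_Mapping.lookup (h e) t = 0)" for h
    unfolding N_def T_def D_iff by (auto simp: in_keys_iff subset_iff)
  have coset: "(\<Union>h\<in>N. {\<lambda>i. h i + x i}) = K x" if x: "x \<in> D e" for x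
  proof (intro Set.set_eqI iffI)
    fix y assume "y \<in> (\<Union>h\<in>N. {\<lambda>i. h i + x i})"
    then obtain h where "h \<in> N" "y = (\<lambda>i. h i + x i)" by blast
    then show "y \<in> K x" using D_add[of h e x] x by (auto simp: K_def N_iff lookup_add)
  next
    fix y assume y: "y \<in> K x"
    then have "(\<lambda>i. y i - x i) \<in> N" using D_diff[of y e x] x by (auto simp: K_def N_iff lookup_minus)
    then show "y \<in> (\<Union>h\<in>N. {\<lambda>i. h i + x i})" by (intro UN_I[of "\<lambda>i. y i - x i"]) auto
  qed
  have self: "x \<in> K x" if "x \<in> D e" for x using that by (simp add: K_def)
  have K_sub: "K x \<subseteq> D e" for x by (auto simp: K_def)
  have K_eqI: "K x = K y" if "\<And>t. t \<in> T \<Longrightarrow> Poly_Mapping.lookup (x e) t = Poly_Mapping.lookup (y e) t" for x y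
    using that by (simp add: K_def)
  have \<phi>: "\<phi> (K x) = (\<lambda>t. if t \<in> T then Poly_Mapping.lookup (x e) t else 0)" if "x \<in> D e" for x
  proof -
    have "(SOME y. y \<in> K x) \<in> K x" using self[OF that] by (rule someI[where P = "\<lambda>y. y \<in> K x"])
    then show ?thesis unfolding \<phi>_def by (auto simp: K_def fun_eq_iff)
  qed
  have carr: "carrier Q = K ` D e"
    using coset by (simp add: Q_def quotient_module_def A_RCOSETS_def' a_r_coset_def') blast
  have zeroD: "(\<lambda>_. 0) \<in> D e" by (simp add: D_iff)
  have zero: "\<zero>\<^bsub>Q\<^esub> = K (\<lambda>_. 0)"
    by (auto simp: Q_def quotient_module_def K_def N_iff)
  have plus: "K x \<oplus>\<^bsub>Q\<^esub> K y = K (\<lambda>i. x i + y i)" if xy: "x \<in> D e" "y \<in> D e" for x y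
  proof -
    have "K x \<oplus>\<^bsub>Q\<^esub> K y = (\<Union>h\<in>K x. \<Union>k\<in>K y. {\<lambda>i. h i + k i})"
      by (simp add: Q_def quotient_module_def set_add_def')
    also have "\<dots> = K (\<lambda>i. x i + y i)"
    proof (intro Set.set_eqI iffI)
      fix z assume "z \<in> (\<Union>h\<in>K x. \<Union>k\<in>K y. {\<lambda>i. h i + k i})"
      then obtain h k where "h \<in> K x" "k \<in> K y" "z = (\<lambda>i. h i + k i)" by blast
      then show "z \<in> K (\<lambda>i. x i + y i)" using D_add[of h e k] by (auto simp: K_def lookup_add)
    next
      fix z assume z: "z \<in> K (\<lambda>i. x i + y i)"
      then have "(\<lambda>i. z i - x i) \<in> K y"
        using D_diff[of z e x] xy by (auto simp: K_def lookup_add lookup_minus)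
      moreover have "z = (\<lambda>i. x i + (z i - x i))" by auto
      ultimately show "z \<in> (\<Union>h\<in>K x. \<Union>k\<in>K y. {\<lambda>i. h i + k i})" using self[OF xy(1)] by blast
    qed
    finally show ?thesis .
  qed
  \<comment> \<open>A left scalar has degree 0, so the Frobenius exponent is
    \<open>p ^ 0 = 1\<close> and the action on coefficients is ordinary multiplication.\<close>
  have act: "(f \<otimes>\<^bsub>A\<^esub> x) \<in> D e" "Poly_Mapping.lookup ((f \<otimes>\<^bsub>A\<^esub> x) e) t = \<psi> f * Poly_Mapping.lookup (x e) t"
    if f: "f \<in> D 0" and x: "x \<in> D e" for f x t
  proof -
    obtain c where c: "f = hom_elt 0 (Poly_Mapping.single 0 c)" using f D_0 by blast
    have xe: "x = hom_elt e (x e)" using x by (auto simp: D_iff hom_elt_def)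
    have "f \<otimes>\<^bsub>A\<^esub> x = hom_elt e (Poly_Mapping.single 0 c * x e)"
      using mult_hom_elt[of 0 "Poly_Mapping.single 0 c" e "x e"] c xe by simp
    moreover have "Poly_Mapping.keys (Poly_Mapping.single 0 c * x e) \<subseteq> Poly_Mapping.keys (x e)"
      by (auto simp: in_keys_iff lookup_scalar_mult)
    moreover have "\<psi> f = c" by (simp add: \<psi>_def c hom_elt_def)
    ultimately show "(f \<otimes>\<^bsub>A\<^esub> x) \<in> D e"
      "Poly_Mapping.lookup ((f \<otimes>\<^bsub>A\<^esub> x) e) t = \<psi> f * Poly_Mapping.lookup (x e) t"
      using x hom_elt_in_D[of "Poly_Mapping.single 0 c * x e" e]
      by (auto simp: D_iff hom_elt_def lookup_scalar_mult simp del: A_simps)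
  qed
  have smult: "f \<odot>\<^bsub>Q\<^esub> K x = K (f \<otimes>\<^bsub>A\<^esub> x)" if f: "f \<in> D 0" and x: "x \<in> D e" for f x
  proof -
    have "f \<odot>\<^bsub>Q\<^esub> K x = (\<Union>y\<in>K x. \<Union>h\<in>N. {\<lambda>i. h i + (f \<otimes>\<^bsub>A\<^esub> y) i})"
      by (simp add: Q_def quotient_module_def a_r_coset_def')
    also have "\<dots> = (\<Union>y\<in>K x. K (f \<otimes>\<^bsub>A\<^esub> y))"
      using coset act(1)[OF f] K_sub by (intro SUP_cong refl) blast
    \<comment> \<open>The coefficients of the product on \<open>T\<close> do not depend on the
      representative \<open>y\<close>, so all cosets in the union coincide.\<close>
    also have "\<dots> = (\<Union>y\<in>K x. K (f \<otimes>\<^bsub>A\<^esub> x))"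
    proof (intro SUP_cong refl K_eqI)
      fix y t assume "y \<in> K x" "t \<in> T"
      then show "Poly_Mapping.lookup ((f \<otimes>\<^bsub>A\<^esub> y) e) t = Poly_Mapping.lookup ((f \<otimes>\<^bsub>A\<^esub> x) e) t"
        using act(2)[OF f] x by (simp add: K_def del: A_simps)
    qed
    also have "\<dots> = K (f \<otimes>\<^bsub>A\<^esub> x)" using self[OF x] by blast
    finally show ?thesis .
  qed
  have "min_num_generators (A\<lparr>carrier := D 0\<rparr>) Q = card T"
  proof (rule min_num_generators_free[where \<phi> = \<phi> and \<psi> = \<psi>])
    show "finite T" by (simp add: T_def finite_monomials)
    show "bij_betw \<phi> (carrier Q) {v. \<forall>t. t \<notin> T \<longrightarrow> v t = 0}"
      unfolding bij_betw_def
    proof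
      show "inj_on \<phi> (carrier Q)"
      proof (rule inj_onI)
        fix X Y assume "X \<in> carrier Q" "Y \<in> carrier Q" and eq: "\<phi> X = \<phi> Y"
        then obtain x y where xy: "X = K x" "Y = K y" "x \<in> D e" "y \<in> D e" unfolding carr by blast
        have "Poly_Mapping.lookup (x e) t = Poly_Mapping.lookup (y e) t" if "t \<in> T" for t
          using fun_cong[OF eq, of t] that unfolding xy \<phi>[OF xy(3)] \<phi>[OF xy(4)] by simp
        then show "X = Y" unfolding xy by (rule K_eqI)
      qed
      show "\<phi> ` carrier Q = {v. \<forall>t. t \<notin> T \<longrightarrow> v t = 0}"
      proof (intro subset_antisym subsetI)
        fix v assume "v \<in> \<phi> ` carrier Q"
        then show "v \<in> {v. \<forall>t. t \<notin> T \<longrightarrow> v t = 0}" by (auto simp: \<phi>_def)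
      next
        fix v :: "(nat \<Rightarrow>\<^sub>0 nat) \<Rightarrow> 'a" assume v: "v \<in> {v. \<forall>t. t \<notin> T \<longrightarrow> v t = 0}"
        have "finite {t. v t \<noteq> 0}"
          by (rule finite_subset[of _ T]) (use v in \<open>auto simp: T_def finite_monomials\<close>)
        then obtain g where g: "Poly_Mapping.lookup g = v" using lookup_Abs_poly_mapping by blast
        have "Poly_Mapping.keys g \<subseteq> mons e" using v by (auto simp: in_keys_iff g T_def)
        then have gD: "hom_elt e g \<in> D e" by (rule hom_elt_in_D)
        have "\<phi> (K (hom_elt e g)) = v" unfolding \<phi>[OF gD] using v by (auto simp: hom_elt_def g fun_eq_iff)
        then show "v \<in> \<phi> ` carrier Q" using gD unfolding carr by blast
      qed
    qed
    show "X \<oplus>\<^bsub>Q\<^esub> Y \<in> carrier Q \<and> \<phi> (X \<oplus>\<^bsub>Q\<^esub> Y) = (\<lambda>t. \<phi> X t + \<phi> Y t)"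
      if "X \<in> carrier Q" "Y \<in> carrier Q" for X Y
    proof -
      obtain x y where xy: "X = K x" "Y = K y" "x \<in> D e" "y \<in> D e" using \<open>X \<in> carrier Q\<close> \<open>Y \<in> carrier Q\<close> unfolding carr by blast
      show ?thesis unfolding xy plus[OF xy(3,4)] carr using D_add[OF xy(3,4)]
        by (auto simp: \<phi> xy lookup_add)
    qed
    show "\<zero>\<^bsub>Q\<^esub> \<in> carrier Q" "\<phi> \<zero>\<^bsub>Q\<^esub> = (\<lambda>_. 0)"
      using zeroD by (auto simp: zero carr \<phi>)
    show "\<psi> ` carrier (A\<lparr>carrier := D 0\<rparr>) = UNIV"
    proof (intro subset_antisym subsetI)
      fix c :: 'a
      have "hom_elt 0 (Poly_Mapping.single 0 c) \<in> D 0" using D_0 by blast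
      then show "c \<in> \<psi> ` carrier (A\<lparr>carrier := D 0\<rparr>)"
        by (intro image_eqI[of _ _ "hom_elt 0 (Poly_Mapping.single 0 c)"]) (auto simp: \<psi>_def hom_elt_def)
    qed simp
    show "f \<odot>\<^bsub>Q\<^esub> X \<in> carrier Q \<and> \<phi> (f \<odot>\<^bsub>Q\<^esub> X) = (\<lambda>t. \<psi> f * \<phi> X t)"
      if "f \<in> carrier (A\<lparr>carrier := D 0\<rparr>)" "X \<in> carrier Q" for f X
    proof -
      obtain x where x: "X = K x" "x \<in> D e" using \<open>X \<in> carrier Q\<close> unfolding carr by blast
      have f: "f \<in> D 0" using \<open>f \<in> carrier (A\<lparr>carrier := D 0\<rparr>)\<close> by simp
      show ?thesis unfolding x(1) smult[OF f x(2)] carr \<phi>[OF act(1)[OF f x(2)]] \<phi>[OF x(2)] act(2)[OF f x(2)]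
        using act(1)[OF f x(2)] by (auto simp del: A_simps)
    qed
  qed
  then show ?thesis
    unfolding complexity_def G_below_D[OF e] by (simp add: Q_def N_def T_def)
qed

end

section \<open>The recurrence for the complexity sequence\<close>

theorem theorem4p4:
  fixes p r m s :: nat
    and P :: "nat \<Rightarrow> ((nat \<Rightarrow>\<^sub>0 nat) \<Rightarrow>\<^sub>0 'a::comm_ring_1) set"
    and c :: "nat \<Rightarrow> nat"
    and a :: "nat \<Rightarrow> rat"
  assumes "prime p"
    and "CHAR('a) = p"
    and "0 < r" and "0 < m" and "r + 1 < m"
    and P: "P = veronese r (poly_piece m)"
    and c: "\<And>e. c e = complexity (twisted_ring p P) (twisted_piece p P) e"
    and minpoly: "is_minimal_poly (U_mat p r m)
      (Polynomial.monom 1 s + (\<Sum>i=1..s. Polynomial.monom (a i) (s - i)))"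
  shows "\<forall>e\<ge>2. of_nat (c (e + s)) + (\<Sum>i=1..s. a i * of_nat (c (e + s - i))) = 0"
proof (intro allI impI)
  fix e :: nat assume "2 \<le> e"
  \<comment> \<open>The transfer formula starts in degree 2: one digit position creates a state and
    one high part closes it.\<close>
  then obtain n where e: "e = Suc (Suc n)" by (metis Suc_le_D numeral_2_eq_2 Suc_le_mono)
  interpret twisted_veronese p r m "twisted_ring p P" "twisted_piece p P"
    by unfold_locales (simp_all add: assms)
  define q where "q = Polynomial.monom 1 s + (\<Sum>i=1..s. Polynomial.monom (a i) (s - i))"
  define N where "N k = (of_nat (card (heavy_exps p r m (Suc (n + k)) (exps m) 0)) :: rat)" for k
  have cN: "of_nat (c (e + k)) = N k" for k
  proof -
    have "c (e + k) = card (heavy_exps p r m (Suc (n + k)) (exps m) 0)"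
      unfolding c e using card_indecomposables[OF p_pos, of m r "Suc (n + k)"]
        complexity_eq_card[of "Suc (Suc (n + k))"] by simp
    then show ?thesis by (simp add: N_def)
  qed
  have coeff: "poly.coeff q k = (if k = s then 1 else 0) + (\<Sum>i=1..s. if k = s - i then a i else 0)" for k
    unfolding q_def by (auto simp: Polynomial.coeff_sum intro!: sum.cong)
  have "(\<Sum>k\<le>Polynomial.degree q. poly.coeff q k * N k) = 0"
    using heavy_exps_recurrence[OF prime_ge_2_nat[OF prime], of q r m n] minpoly
    unfolding is_minimal_poly_def q_def[symmetric] N_def by blast
  moreover have "(\<Sum>k\<le>Polynomial.degree q. poly.coeff q k * N k) = (\<Sum>k\<le>s. poly.coeff q k * N k)"
  proof (rule sum.mono_neutral_left)
    have "Polynomial.degree q \<le> s" by (rule degree_le) (auto simp: coeff intro!: sum.neutral)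
    then show "{..Polynomial.degree q} \<subseteq> {..s}" by simp
  qed (auto simp: coeff_eq_0)
  moreover have "(\<Sum>k\<le>s. poly.coeff q k * N k) = N s + (\<Sum>i=1..s. a i * N (s - i))"
  proof -
    have "(\<Sum>k\<le>s. poly.coeff q k * N k) =
        (\<Sum>k\<le>s. if k = s then N k else 0) + (\<Sum>k\<le>s. \<Sum>i=1..s. if k = s - i then a i * N k else 0)"
      unfolding coeff distrib_right sum_distrib_right sum.distrib
      by (intro arg_cong2[of _ _ _ _ "(+)"] sum.cong refl) auto
    \<comment> \<open>After the swap, each \<open>i\<close> selects the single index
      \<open>k = s - i\<close>.\<close>
    also have "(\<Sum>k\<le>s. \<Sum>i=1..s. if k = s - i then a i * N k else 0) = (\<Sum>i=1..s. a i * N (s - i))"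
      by (subst sum.swap) simp
    finally show ?thesis by simp
  qed
  ultimately have "N s + (\<Sum>i=1..s. a i * N (s - i)) = 0" by simp
  \<comment> \<open>For \<open>i \<le> s\<close>, truncated subtraction gives
    \<open>e + s - i = e + (s - i)\<close>.\<close>
  moreover have "(\<Sum>i=1..s. a i * of_nat (c (e + s - i))) = (\<Sum>i=1..s. a i * N (s - i))"
    by (intro sum.cong refl) (simp flip: cN)
  ultimately show "of_nat (c (e + s)) + (\<Sum>i=1..s. a i * of_nat (c (e + s - i))) = 0"
    by (simp only: cN)
qed

end
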